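(* Let $\Omega\subset\mathbb{C}^n$ be a bounded domain, let $1<p<\infty$, and let $q$ be conjugate to $p$, i.e. $\frac1p+\frac1q=1$. Suppose there exists a bounded linear operator $\mathbf{P}:L^2(\Omega)\to A^2(\Omega)$ given by an integral formula $\mathbf{P}f(z)=\int_\Omega P(z,w)f(w)\,dV(w)$ such that (i) $|\mathbf{P}|$ is bounded on $L^p(\Omega)$: there is $C>0$ with $\big\||\mathbf{P}|f\big\|_p\le C\|f\|_p$ for all $f\in L^p(\Omega)$; (ii) $\mathbf{P}h=h$ for all $h\in A^p(\Omega)$; (iii) the range of $\mathbf{P}^\dagger$ is contained in $\mathcal{O}(\Omega)$, i.e. $\mathbf{P}^\dagger g\in\mathcal{O}(\Omega)$ for all $g\in L^q(\Omega)$. Then the conjugate-linear map $\Phi_p:A^q(\Omega)\to A^p(\Omega)'$ defined by $\Phi_p(g)(f)=\int_\Omega f\,\overline{g}\,dV$ is surjective.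
   Context: $dV$ is Lebesgue measure; $\mathcal{O}(\Omega)$ is the set of holomorphic functions on $\Omega$; $A^p(\Omega)=\mathcal{O}(\Omega)\cap L^p(\Omega)$ is the Bergman space with the $L^p$ norm $\|\cdot\|_p$; $X'$ denotes the dual space (bounded linear functionals) of a normed space $X$. For an operator $\mathbf{P}$ with kernel $P(z,w)$, define $|\mathbf{P}|f(z)=\int_\Omega |P(z,w)|f(w)\,dV(w)$ and $\mathbf{P}^\dagger f(w)=\int_\Omega\overline{P(z,w)}f(z)\,dV(z)$. These operators and $\mathbf{P}$ itself are defined on $L^p$ or $L^q$ functions by the integrals whenever these converge (almost everywhere). *)

theory Defs
  imports "HOL-Analysis.Analysis"
begin

text \<open>
  The space of \<open>n\<close> complex variables is \<^typ>\<open>complex^'n\<close>.  Functions on a domain \<open>\<Omega>\<close> are total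
  functions whose values outside \<open>\<Omega>\<close> are irrelevant, and \<open>L\<^sup>p\<close> consists of functions, not of
  classes modulo almost everywhere equality.  A functional or operator that is linear and bounded
  for the seminorm \<open>Lp_norm\<close> automatically descends to these classes.
\<close>

definition holomorphic_several :: "(complex^'n \<Rightarrow> complex) \<Rightarrow> (complex^'n) set \<Rightarrow> bool" where
  "holomorphic_several f \<Omega> \<longleftrightarrow>
     (\<forall>z\<in>\<Omega>. \<exists>D. (f has_derivative D) (at z) \<and> (\<forall>c v. D (c *s v) = c * D v))"

definition Lp_space :: "real \<Rightarrow> (complex^'n) set \<Rightarrow> (complex^'n \<Rightarrow> complex) set" where
  "Lp_space p \<Omega> = {f. f \<in> borel_measurable (lebesgue_on \<Omega>) \<and>
     integrable (lebesgue_on \<Omega>) (\<lambda>z. norm (f z) powr p)}"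

definition Lp_norm :: "real \<Rightarrow> (complex^'n) set \<Rightarrow> (complex^'n \<Rightarrow> complex) \<Rightarrow> real" where
  "Lp_norm p \<Omega> f = (LINT z|lebesgue_on \<Omega>. norm (f z) powr p) powr (1 / p)"

definition bergman :: "real \<Rightarrow> (complex^'n) set \<Rightarrow> (complex^'n \<Rightarrow> complex) set" where
  "bergman p \<Omega> = {f. holomorphic_several f \<Omega>} \<inter> Lp_space p \<Omega>"

definition bergman_dual ::
    "real \<Rightarrow> (complex^'n) set \<Rightarrow> ((complex^'n \<Rightarrow> complex) \<Rightarrow> complex) set" where
  "bergman_dual p \<Omega> = {l \<in> extensional (bergman p \<Omega>).
     (\<forall>f\<in>bergman p \<Omega>. \<forall>g\<in>bergman p \<Omega>. l (\<lambda>z. f z + g z) = l f + l g) \<and>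
     (\<forall>c. \<forall>f\<in>bergman p \<Omega>. l (\<lambda>z. c * f z) = c * l f) \<and>
     (\<exists>C. \<forall>f\<in>bergman p \<Omega>. norm (l f) \<le> C * Lp_norm p \<Omega> f)}"

definition bounded_linear_Lp_bergman :: "real \<Rightarrow> (complex^'n) set \<Rightarrow>
    ((complex^'n \<Rightarrow> complex) \<Rightarrow> complex^'n \<Rightarrow> complex) \<Rightarrow> bool" where
  "bounded_linear_Lp_bergman p \<Omega> T \<longleftrightarrow>
     T \<in> Lp_space p \<Omega> \<rightarrow> bergman p \<Omega> \<and>
     (\<forall>f\<in>Lp_space p \<Omega>. \<forall>g\<in>Lp_space p \<Omega>. \<forall>z\<in>\<Omega>. T (\<lambda>w. f w + g w) z = T f z + T g z) \<and>
     (\<forall>c. \<forall>f\<in>Lp_space p \<Omega>. \<forall>z\<in>\<Omega>. T (\<lambda>w. c * f w) z = c * T f z) \<and>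
     (\<exists>C. \<forall>f\<in>Lp_space p \<Omega>. Lp_norm p \<Omega> (T f) \<le> C * Lp_norm p \<Omega> f)"

text \<open>
  The Bochner integral of a non-integrable function is \<open>0\<close>, so convergence of the defining
  integral (at almost every point) has to be required separately.
\<close>

definition kernel_op :: "(complex^'n) set \<Rightarrow> (complex^'n \<Rightarrow> complex^'n \<Rightarrow> complex) \<Rightarrow>
    (complex^'n \<Rightarrow> complex) \<Rightarrow> complex^'n \<Rightarrow> complex" where
  "kernel_op \<Omega> K f z = (LINT w|lebesgue_on \<Omega>. K z w * f w)"

definition kernel_op_converges :: "(complex^'n) set \<Rightarrow>
    (complex^'n \<Rightarrow> complex^'n \<Rightarrow> complex) \<Rightarrow> (complex^'n \<Rightarrow> complex) \<Rightarrow> bool" where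
  "kernel_op_converges \<Omega> K f \<longleftrightarrow>
     (AE z in lebesgue_on \<Omega>. integrable (lebesgue_on \<Omega>) (\<lambda>w. K z w * f w))"

definition abs_kernel :: "('a \<Rightarrow> 'a \<Rightarrow> complex) \<Rightarrow> 'a \<Rightarrow> 'a \<Rightarrow> complex" where
  "abs_kernel K = (\<lambda>z w. complex_of_real (norm (K z w)))"

definition adjoint_kernel :: "('a \<Rightarrow> 'a \<Rightarrow> complex) \<Rightarrow> 'a \<Rightarrow> 'a \<Rightarrow> complex" where
  "adjoint_kernel K = (\<lambda>w z. cnj (K z w))"

definition bergman_pairing :: "real \<Rightarrow> (complex^'n) set \<Rightarrow>
    (complex^'n \<Rightarrow> complex) \<Rightarrow> (complex^'n \<Rightarrow> complex) \<Rightarrow> complex" where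
  "bergman_pairing p \<Omega> g = (\<lambda>f\<in>bergman p \<Omega>. LINT z|lebesgue_on \<Omega>. f z * cnj (g z))"

text \<open>The sum and the multiples of functionals are taken pointwise on the Bergman space.\<close>

definition conjugate_linear_on_bergman :: "real \<Rightarrow> real \<Rightarrow> (complex^'n) set \<Rightarrow>
    ((complex^'n \<Rightarrow> complex) \<Rightarrow> (complex^'n \<Rightarrow> complex) \<Rightarrow> complex) \<Rightarrow> bool" where
  "conjugate_linear_on_bergman q p \<Omega> \<Phi> \<longleftrightarrow>
     (\<forall>g\<in>bergman q \<Omega>. \<forall>h\<in>bergman q \<Omega>. \<forall>f\<in>bergman p \<Omega>.
        \<Phi> (\<lambda>z. g z + h z) f = \<Phi> g f + \<Phi> h f) \<and>
     (\<forall>c. \<forall>g\<in>bergman q \<Omega>. \<forall>f\<in>bergman p \<Omega>. \<Phi> (\<lambda>z. c * g z) f = cnj c * \<Phi> g f)"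

end

theory Submission
  imports Defs
begin

text \<open>
  The functional is represented by an \<open>L\<^sup>q\<close> function without Hahn-Banach and Riesz: for a bounded
  linear functional \<open>l\<close> on a subspace \<open>V\<close> of \<open>L\<^sup>p\<close>, a minimising sequence in \<open>V\<close> of
  \<open>J f = (1/p) \<integral> \<bar>f\<bar>\<^sup>p - Re (l f)\<close> is Cauchy by uniform convexity.  Its limit \<open>f\<^sub>0\<close> in \<open>L\<^sup>p\<close> need not
  lie in \<open>V\<close>, but the first variation of \<open>J\<close> still gives \<open>l h = \<integral> h cnj g\<close> for \<open>h\<close> in \<open>V\<close>, where
  \<open>g = \<bar>f\<^sub>0\<bar>\<^sup>(\<^sup>p\<^sup>-\<^sup>2\<^sup>) f\<^sub>0\<close>.

  With \<open>V\<close> the Bergman space, the reproducing property and Fubini's theorem allow \<open>g\<close> to be replaced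
  by \<open>P\<^sup>\<dagger> g\<close>, which is holomorphic by hypothesis.  It lies in \<open>L\<^sup>q\<close> because
  \<open>f \<mapsto> \<integral> f cnj (P\<^sup>\<dagger> g)\<close> is bounded on \<open>L\<^sup>p\<close>, by the same representation applied to \<open>V = L\<^sup>p\<close>.
\<close>

subsection \<open>Uniform convexity of powers of the norm\<close>

text \<open>The derivative \<open>p * t powr (p - 1)\<close> is strictly increasing, so the mean
  value theorem compares the slope of a secant through \<open>m\<close> with the tangent slope at
  \<open>m\<close>. The endpoint 0 is handled separately because the power is differentiated only at
  positive points.\<close>

lemma powr_tangent_strict:
  fixes x m p :: real
  assumes "1 < p" "0 \<le> x" "0 \<le> m" "x \<noteq> m"
  shows "m powr p + p * m powr (p - 1) * (x - m) < x powr p"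
proof -
  consider "m = 0" | "m > 0" "x = 0" | "m > 0" "x > 0"
    using assms by linarith
  then show ?thesis
  proof cases
    case 1
    then show ?thesis using assms by simp
  next
    case 2
    have "m powr (p - 1) * m = m powr p"
      using 2 powr_mult_base[of m "p - 1"] by (simp add: mult.commute)
    then have "m powr p + p * m powr (p - 1) * (x - m) = (1 - p) * m powr p"
      using 2 by (simp add: algebra_simps)
    also have "\<dots> < 0"
      using 2 assms by (simp add: mult_neg_pos)
    finally show ?thesis using 2 by simp
  next
    case 3
    have der: "((\<lambda>t. t powr p) has_real_derivative p * t powr (p - 1)) (at t)" if "t > 0" for t
      using that by (auto intro!: derivative_eq_intros)
    show ?thesis
    proof (cases "x < m")
      case True
      obtain z where z: "x < z" "z < m" "m powr p - x powr p = (m - x) * (p * z powr (p - 1))"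
        using MVT2[OF True, of "\<lambda>t. t powr p" "\<lambda>t. p * t powr (p - 1)"] der 3 by force
      have "z powr (p - 1) < m powr (p - 1)"
        using z 3 assms by (intro powr_less_mono2) auto
      then have "(m - x) * (p * z powr (p - 1)) < (m - x) * (p * m powr (p - 1))"
        using True assms by (intro mult_strict_left_mono) auto
      then show ?thesis using z(3) by (simp add: algebra_simps)
    next
      case False
      then have "m < x" using assms by simp
      obtain z where z: "m < z" "z < x" "x powr p - m powr p = (x - m) * (p * z powr (p - 1))"
        using MVT2[OF \<open>m < x\<close>, of "\<lambda>t. t powr p" "\<lambda>t. p * t powr (p - 1)"] der 3 by force
      have "m powr (p - 1) < z powr (p - 1)"
        using z 3 assms by (intro powr_less_mono2) auto
      then have "(x - m) * (p * m powr (p - 1)) < (x - m) * (p * z powr (p - 1))"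
        using \<open>m < x\<close> assms by (intro mult_strict_left_mono) auto
      then show ?thesis using z(3) by (simp add: algebra_simps)
    qed
  qed
qed

lemma powr_tangent:
  fixes x m p :: real
  assumes "1 < p" "0 \<le> x" "0 \<le> m"
  shows "m powr p + p * m powr (p - 1) * (x - m) \<le> x powr p"
  using powr_tangent_strict[OF assms] by (cases "x = m") auto

text \<open>The two tangent inequalities at the midpoint are averaged; their linear terms are
  opposite and cancel.\<close>

lemma powr_midpoint_strict:
  fixes x y p :: real
  assumes "1 < p" "0 \<le> x" "0 \<le> y" "x \<noteq> y"
  shows "((x + y) / 2) powr p < (x powr p + y powr p) / 2"
proof -
  let ?m = "(x + y) / 2"
  have "?m powr p + p * ?m powr (p - 1) * (x - ?m) < x powr p"
    and "?m powr p + p * ?m powr (p - 1) * (y - ?m) < y powr p"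
    using assms by (intro powr_tangent_strict; simp add: field_simps)+
  moreover have "p * ?m powr (p - 1) * (y - ?m) = - (p * ?m powr (p - 1) * (x - ?m))"
    by (simp add: field_simps)
  \<comment> \<open>The averaging is stated for abstract reals so that the arithmetic stays linear
    and the powers act as atoms.\<close>
  moreover have "C < (u + v) / 2" if "C + D < u" "C + E < v" "E = - D" for C D E u v :: real
    using that by (simp add: field_simps)
  ultimately show ?thesis by blast
qed

text \<open>Strictness has two sources. If the norms differ, it comes from strict convexity of the
  scalar power; if they agree, the parallelogram law makes the midpoint strictly shorter.\<close>

lemma norm_midpoint_powr_strict:
  fixes a b :: "'a::real_inner"
  assumes "1 < p" "a \<noteq> b"
  shows "norm ((1/2) *\<^sub>R (a + b)) powr p < (norm a powr p + norm b powr p) / 2"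
proof -
  have le: "norm ((1/2) *\<^sub>R (a + b)) \<le> (norm a + norm b) / 2"
    using norm_triangle_ineq[of a b] by simp
  show ?thesis
  proof (cases "norm a = norm b")
    case False
    have "norm ((1/2) *\<^sub>R (a + b)) powr p \<le> ((norm a + norm b) / 2) powr p"
      using assms le by (intro powr_mono2) auto
    also have "\<dots> < (norm a powr p + norm b powr p) / 2"
      using assms False by (intro powr_midpoint_strict) auto
    finally show ?thesis .
  next
    case True
    have "(norm (a + b))\<^sup>2 + (norm (a - b))\<^sup>2 = 4 * (norm a)\<^sup>2"
      using True by (simp add: power2_norm_eq_inner inner_simps inner_commute norm_eq)
    moreover have "(norm (a - b))\<^sup>2 > 0" using assms by simp
    ultimately have "(norm (a + b))\<^sup>2 < 4 * (norm a)\<^sup>2" by linarith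
    then have "(norm (a + b))\<^sup>2 < (2 * norm a)\<^sup>2" by (simp add: power_mult_distrib)
    then have "norm (a + b) < 2 * norm a"
      by (rule power_less_imp_less_base) simp
    then have "norm ((1/2) *\<^sub>R (a + b)) < norm a" by simp
    then have "norm ((1/2) *\<^sub>R (a + b)) powr p < norm a powr p"
      using assms by (intro powr_less_mono2) auto
    then show ?thesis using True by simp
  qed
qed

lemma norm_midpoint_powr:
  fixes a b :: "'a::real_inner"
  assumes "1 < p"
  shows "norm ((1/2) *\<^sub>R (a + b)) powr p \<le> (norm a powr p + norm b powr p) / 2"
proof (cases "a = b")
  case True
  then show ?thesis by (simp flip: scaleR_2)
next
  case False
  then show ?thesis using norm_midpoint_powr_strict[OF assms, of a b] by linarith
qed

text \<open>A crude consequence of midpoint convexity, enough for closure of \<open>L^p\<close>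
  under sums before Minkowski's inequality is available.\<close>

lemma norm_add_powr_le:
  fixes a b :: "'a::real_inner"
  assumes "1 < p"
  shows "norm (a + b) powr p \<le> 2 powr p * (norm a powr p + norm b powr p)"
proof -
  have "norm ((1/2) *\<^sub>R (a + b)) powr p \<le> (norm a powr p + norm b powr p) / 2"
    by (rule norm_midpoint_powr[OF assms])
  then have "(norm (a + b) / 2) powr p \<le> norm a powr p + norm b powr p"
    by simp (smt (verit) powr_ge_zero)
  then show ?thesis by (simp add: powr_divide field_simps)
qed

text \<open>Uniform convexity in a form linear in the p-th powers and in the midpoint defect. Since
  \<open>K\<close> does not depend on \<open>a\<close> and \<open>b\<close>, the inequality can be
  integrated: a small integrated defect forces a small \<open>L^p\<close> distance.\<close>

lemma norm_powr_uniformly_convex: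
  fixes p e :: real
  assumes p: "1 < p" and e: "0 < e"
  obtains K where "0 \<le> K" "\<And>a b :: 'a::euclidean_space.
    norm (a - b) powr p \<le> e * (norm a powr p + norm b powr p) +
      K * ((norm a powr p + norm b powr p) / 2 - norm ((1/2) *\<^sub>R (a + b)) powr p)"
proof -
  let ?S = "\<lambda>x :: 'a \<times> 'a. norm (fst x) powr p + norm (snd x) powr p"
  let ?d = "\<lambda>x :: 'a \<times> 'a. norm (fst x - snd x) powr p"
  let ?\<phi> = "\<lambda>x :: 'a \<times> 'a. ?S x / 2 - norm ((1/2) *\<^sub>R (fst x + snd x)) powr p"
  \<comment> \<open>Normalised pairs that are still at least \<open>e\<close> apart. This set is
    compact and the defect \<open>?\<phi>\<close> is positive on it, hence bounded away from
    0.\<close>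
  define X where "X = {x. ?S x = 1 \<and> e \<le> ?d x}"
  have cont: "continuous_on UNIV ?S" "continuous_on UNIV ?d" "continuous_on UNIV ?\<phi>"
    using p by (auto intro!: continuous_intros continuous_on_powr')
  have "closed X"
    unfolding X_def using cont by (intro closed_Collect_conj closed_Collect_eq closed_Collect_le continuous_on_const) auto
  moreover have "bounded X"
  proof -
    have "norm x \<le> 2" if "x \<in> X" for x
    proof -
      have "norm (fst x) powr p \<le> 1 powr p" "norm (snd x) powr p \<le> 1 powr p"
        using that by (auto simp: X_def intro: add_le_same_cancel2[THEN iffD1] order_trans)
           (metis le_add_same_cancel1 powr_ge_zero, metis le_add_same_cancel2 powr_ge_zero)
      then have "norm (fst x) \<le> 1" "norm (snd x) \<le> 1"
        using p powr_less_mono2[of p 1 "norm (fst x)"] powr_less_mono2[of p 1 "norm (snd x)"]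
        by (auto simp: not_le[symmetric])
      then show ?thesis using norm_Pair_le[of "fst x" "snd x"] by simp
    qed
    then show ?thesis unfolding bounded_iff by blast
  qed
  ultimately have "compact X" by (simp add: compact_eq_bounded_closed)
  have phi_pos: "0 < ?\<phi> x" if "x \<in> X" for x
  proof -
    have "fst x \<noteq> snd x" using that e p by (auto simp: X_def)
    then show ?thesis using norm_midpoint_powr_strict[OF p, of "fst x" "snd x"] by simp
  qed
  \<comment> \<open>For large \<open>e\<close> the set \<open>X\<close> is empty, and then any
    positive number serves.\<close>
  obtain \<delta> where d: "0 < \<delta>" "\<And>x. x \<in> X \<Longrightarrow> \<delta> \<le> ?\<phi> x"
  proof (cases "X = {}")
    case True
    then show ?thesis using that[of 1] by simp
  next
    case False
    then obtain x0 where x0: "x0 \<in> X" "\<And>x. x \<in> X \<Longrightarrow> ?\<phi> x0 \<le> ?\<phi> x"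
      using continuous_attains_inf[OF \<open>compact X\<close> False continuous_on_subset[OF cont(3)]] by auto
    then show ?thesis using that[OF phi_pos[OF x0(1)]] by blast
  qed
  have phi_nonneg: "0 \<le> ?\<phi> x" for x
    using norm_midpoint_powr[OF p, of "fst x" "snd x"] by simp
  have d_le: "?d x \<le> 2 powr p * ?S x" for x
    using norm_add_powr_le[OF p, of "fst x" "- snd x"] by simp
  \<comment> \<open>With this choice a defect of at least \<open>\<delta> * ?S x\<close>, multiplied
    by \<open>K\<close>, already exceeds the trivial bound \<open>d_le\<close>.\<close>
  define K where "K = 2 powr p / \<delta>"
  have K: "0 \<le> K" using d by (simp add: K_def)
  \<comment> \<open>Both sides are homogeneous of degree \<open>p\<close>, so it suffices to treat the compact set \<open>?S x = 1\<close>.\<close>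
  have scaled: "?d x \<le> e * ?S x + K * ?\<phi> x" for x
  proof (cases "?S x = 0")
    case True
    then show ?thesis using d_le[of x] phi_nonneg[of x] K by simp
  next
    case False
    then have S: "?S x > 0" by (metis add_nonneg_nonneg less_eq_real_def powr_ge_zero)
    define r where "r = ?S x powr (- (1 / p))"
    have r: "r > 0" using S by (simp add: r_def)
    have rp: "r powr p = 1 / ?S x"
    proof -
      have "r powr p = ?S x powr (- 1)" unfolding r_def powr_powr using p by simp
      then show ?thesis using S powr_neg_one by simp
    qed
    let ?y = "r *\<^sub>R x"
    have y: "?S ?y = r powr p * ?S x" "?d ?y = r powr p * ?d x" "?\<phi> ?y = r powr p * ?\<phi> x"
    proof -
      have sc: "norm (r *\<^sub>R v) powr p = r powr p * norm v powr p" for v :: 'a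
        using r by (simp add: powr_mult)
      have "(1/2) *\<^sub>R (fst ?y + snd ?y) = r *\<^sub>R ((1/2) *\<^sub>R (fst x + snd x))"
        "fst ?y - snd ?y = r *\<^sub>R (fst x - snd x)"
        by (simp_all add: algebra_simps)
      then show "?S ?y = r powr p * ?S x" "?d ?y = r powr p * ?d x" "?\<phi> ?y = r powr p * ?\<phi> x"
        by (simp_all only: sc fst_scaleR snd_scaleR) (simp_all add: algebra_simps)
    qed
    \<comment> \<open>If the normalised pair lies in \<open>X\<close>, the defect term alone
      dominates the distance; otherwise the distance is already below \<open>e\<close> times the sum
      of powers.\<close>
    show ?thesis
    proof (cases "?y \<in> X")
      case True
      then have "\<delta> \<le> r powr p * ?\<phi> x" using d(2)[OF True] y by simp
      then have "\<delta> * ?S x \<le> ?\<phi> x" using S by (simp add: rp field_simps)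
      then have "K * (\<delta> * ?S x) \<le> K * ?\<phi> x" using K by (rule mult_left_mono)
      then have "2 powr p * ?S x \<le> K * ?\<phi> x" using d by (simp add: K_def)
      moreover have "0 \<le> e * ?S x" using e S by simp
      ultimately show ?thesis using d_le[of x] by linarith
    next
      case False
      then have "r powr p * ?d x < e" using y S by (simp add: X_def rp)
      then have "?d x \<le> e * ?S x" using S by (simp add: rp field_simps)
      moreover have "0 \<le> K * ?\<phi> x" using K phi_nonneg[of x] by simp
      ultimately show ?thesis by linarith
    qed
  qed
  show ?thesis
    using that[OF K] scaled[of "(_, _)"] by simp
qed

text \<open>For nonzero \<open>z\<close> this is \<open>|z|^(p-2) z\<close>, the gradient of
  \<open>|z|^p / p\<close>. Writing it with \<open>sgn\<close> gives the value 0 at the origin and,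
  for \<open>1 < p\<close>, avoids negative exponents when \<open>p < 2\<close>.\<close>

definition duality_map :: "real \<Rightarrow> 'a::real_normed_vector \<Rightarrow> 'a" where
  "duality_map p z = norm z powr (p - 1) *\<^sub>R sgn z"

lemma norm_duality_map: "norm (duality_map p z) = norm z powr (p - 1)"
  by (simp add: duality_map_def norm_sgn)

lemma continuous_duality_map:
  assumes "1 < p"
  shows "continuous_on UNIV (duality_map p :: 'a::real_normed_vector \<Rightarrow> 'a)"
proof -
  have "isCont (duality_map p :: 'a \<Rightarrow> 'a) z" for z
  proof (cases "z = 0")
    case True
    have "((\<lambda>z. norm z powr (p - 1)) \<longlongrightarrow> norm (0::'a) powr (p - 1)) (at (0::'a))"
      using assms by (intro tendsto_powr' tendsto_norm tendsto_ident_at tendsto_const) auto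
    then have "((\<lambda>z. norm (duality_map p z :: 'a)) \<longlongrightarrow> 0) (at (0::'a))"
      using assms by (simp add: norm_duality_map)
    then have "(duality_map p \<longlongrightarrow> (0::'a)) (at 0)" by (rule tendsto_norm_zero_cancel)
    then show ?thesis using True by (simp add: isCont_def duality_map_def)
  next
    case False
    then show ?thesis unfolding duality_map_def
      by (intro continuous_intros) auto
  qed
  then show ?thesis by (simp add: continuous_at_imp_continuous_on)
qed

text \<open>The vector form of the tangent inequality: Cauchy-Schwarz against the unit vector
  \<open>sgn b\<close> reduces it to the scalar one at \<open>norm b\<close>.\<close>

lemma norm_powr_tangent:
  fixes a b :: "'a::real_inner"
  assumes "1 < p"
  shows "norm b powr p + p * ((a - b) \<bullet> duality_map p b) \<le> norm a powr p"
proof -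
  have "a \<bullet> sgn b \<le> norm a"
    using norm_cauchy_schwarz[of a "sgn b"] by (cases "b = 0") (auto simp: norm_sgn)
  moreover have "b \<bullet> sgn b = norm b"
    by (cases "b = 0") (simp_all add: sgn_div_norm power2_norm_eq_inner[symmetric] power2_eq_square)
  ultimately have "(a - b) \<bullet> sgn b \<le> norm a - norm b" by (simp add: inner_diff_left)
  then have "p * norm b powr (p - 1) * ((a - b) \<bullet> sgn b) \<le> p * norm b powr (p - 1) * (norm a - norm b)"
    using assms by (intro mult_left_mono) auto
  then show ?thesis
    using powr_tangent[OF assms, of "norm a" "norm b"] by (simp add: duality_map_def)
qed

subsection \<open>Lebesgue spaces\<close>

text \<open>The space is set up over an arbitrary measure, since the functional analysis below uses
  nothing about the domain; \<open>Lp_space_eq\<close> makes the link.\<close>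

definition Lp_fun :: "real \<Rightarrow> 'a measure \<Rightarrow> ('a \<Rightarrow> complex) set" where
  "Lp_fun p M = {f \<in> borel_measurable M. integrable M (\<lambda>x. norm (f x) powr p)}"

definition Lp_seminorm :: "real \<Rightarrow> 'a measure \<Rightarrow> ('a \<Rightarrow> complex) \<Rightarrow> real" where
  "Lp_seminorm p M f = (LINT x|M. norm (f x) powr p) powr (1 / p)"

lemma Lp_funD:
  assumes "f \<in> Lp_fun p M"
  shows "f \<in> borel_measurable M" "integrable M (\<lambda>x. norm (f x) powr p)"
  using assms by (auto simp: Lp_fun_def)

lemma Lp_seminorm_nonneg: "0 \<le> Lp_seminorm p M f"
  by (simp add: Lp_seminorm_def)

lemma Lp_seminorm_powr:
  assumes "p \<noteq> 0"
  shows "Lp_seminorm p M f powr p = (LINT x|M. norm (f x) powr p)"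
  using assms by (simp add: Lp_seminorm_def powr_powr)

lemma Lp_seminorm_eq_0_AE:
  assumes "f \<in> Lp_fun p M" "Lp_seminorm p M f = 0"
  shows "AE x in M. f x = 0"
proof -
  have "(LINT x|M. norm (f x) powr p) = 0"
    using assms(2) by (simp add: Lp_seminorm_def)
  then have "AE x in M. norm (f x) powr p = 0"
    using Lp_funD[OF assms(1)] by (subst (asm) integral_nonneg_eq_0_iff_AE) auto
  then show ?thesis by simp
qed

lemma Lp_seminorm_cong_AE:
  assumes "f \<in> borel_measurable M" "g \<in> borel_measurable M" "AE x in M. norm (f x) = norm (g x)"
  shows "Lp_seminorm p M f = Lp_seminorm p M g"
  unfolding Lp_seminorm_def using assms
  by (intro arg_cong[where f = "\<lambda>x. x powr (1 / p)"] integral_cong_AE) auto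

lemma Lp_fun_bound:
  assumes "f \<in> Lp_fun p M" "g \<in> borel_measurable M" "AE x in M. norm (g x) \<le> norm (f x)" "0 \<le> p"
  shows "g \<in> Lp_fun p M"
proof -
  have "integrable M (\<lambda>x. norm (g x) powr p)"
    using Lp_funD[OF assms(1)] assms(2-)
    by (intro Bochner_Integration.integrable_bound[OF Lp_funD(2)[OF assms(1)]])
       (auto elim!: eventually_mono intro: powr_mono2)
  then show ?thesis using assms by (simp add: Lp_fun_def)
qed

lemma Lp_fun_add:
  assumes f: "f \<in> Lp_fun p M" and g: "g \<in> Lp_fun p M" and p: "1 < p"
  shows "(\<lambda>x. f x + g x) \<in> Lp_fun p M"
proof -
  note [measurable] = Lp_funD(1)[OF f] Lp_funD(1)[OF g]
  have le: "norm (f x + g x) powr p \<le> 2 powr p * (norm (f x) powr p + norm (g x) powr p)" for x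
    by (rule norm_add_powr_le[OF p])
  have "integrable M (\<lambda>x. 2 powr p * (norm (f x) powr p + norm (g x) powr p))"
    using Lp_funD(2)[OF f] Lp_funD(2)[OF g] by simp
  then have "integrable M (\<lambda>x. norm (f x + g x) powr p)"
    by (rule Bochner_Integration.integrable_bound) (use le in \<open>auto intro: order_trans[OF _ abs_ge_self]\<close>)
  then show ?thesis by (simp add: Lp_fun_def)
qed

lemma Lp_fun_cmult:
  assumes "f \<in> Lp_fun p M"
  shows "(\<lambda>x. c * f x) \<in> Lp_fun p M"
  using assms by (auto simp: Lp_fun_def norm_mult powr_mult)

lemma Lp_fun_diff:
  assumes "f \<in> Lp_fun p M" "g \<in> Lp_fun p M" "1 < p"
  shows "(\<lambda>x. f x - g x) \<in> Lp_fun p M"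
  using Lp_fun_add[OF assms(1) Lp_fun_cmult[OF assms(2), of "-1"] assms(3)] by simp

lemma Lp_fun_norm:
  assumes "f \<in> Lp_fun p M"
  shows "(\<lambda>x. complex_of_real (norm (f x))) \<in> Lp_fun p M"
  using assms by (auto simp: Lp_fun_def)

section \<open>Conjugate exponents and the inequalities of Hoelder and Minkowski\<close>

lemma conjugate_exponent:
  fixes p q :: real
  assumes "1 < p" "1 / p + 1 / q = 1"
  shows "1 < q" "(p - 1) * q = p" "1 / q + 1 / p = 1"
proof -
  have "q \<noteq> 0" using assms by (auto simp: field_simps)
  then have pq: "p + q = p * q" using assms by (simp add: field_simps)
  then show "(p - 1) * q = p" by (simp add: algebra_simps)
  then have "q = p / (p - 1)" using assms by (simp add: field_simps)
  then show "1 < q" using assms by simp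
  show "1 / q + 1 / p = 1" using assms by simp
qed

lemma Hoelder_integrable:
  assumes f: "f \<in> Lp_fun p M" and g: "g \<in> Lp_fun q M" and p: "1 < p" and pq: "1 / p + 1 / q = 1"
  shows "integrable M (\<lambda>x. norm (f x) * norm (g x))"
proof -
  note [measurable] = Lp_funD(1)[OF f] Lp_funD(1)[OF g]
  have "integrable M (\<lambda>x. norm (f x) powr p / p + norm (g x) powr q / q)"
    using Lp_funD(2)[OF f] Lp_funD(2)[OF g] by simp
  then show ?thesis
    by (rule Bochner_Integration.integrable_bound)
       (use Youngs_inequality[OF p conjugate_exponent(1)[OF p pq] pq]
         in \<open>auto intro!: order_trans[OF _ abs_ge_self]\<close>)
qed

text \<open>Young's inequality is integrated for the functions divided by their seminorms, where the
  right side becomes \<open>1 / p + 1 / q = 1\<close>. A vanishing seminorm makes the product zero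
  almost everywhere.\<close>

lemma Hoelder_inequality:
  assumes f: "f \<in> Lp_fun p M" and g: "g \<in> Lp_fun q M" and p: "1 < p" and pq: "1 / p + 1 / q = 1"
  shows "(LINT x|M. norm (f x) * norm (g x)) \<le> Lp_seminorm p M f * Lp_seminorm q M g"
proof -
  note [measurable] = Lp_funD(1)[OF f] Lp_funD(1)[OF g]
  let ?A = "Lp_seminorm p M f" and ?B = "Lp_seminorm q M g"
  have q: "1 < q" using conjugate_exponent[OF p pq] by simp
  show ?thesis
  proof (cases "?A = 0 \<or> ?B = 0")
    case True
    then have "AE x in M. norm (f x) * norm (g x) = 0"
      using Lp_seminorm_eq_0_AE[OF f] Lp_seminorm_eq_0_AE[OF g] by (auto elim: eventually_mono)
    then have "(LINT x|M. norm (f x) * norm (g x)) = 0" by (rule integral_eq_zero_AE)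
    then show ?thesis by (simp add: Lp_seminorm_nonneg)
  next
    case False
    then have A: "0 < ?A" and B: "0 < ?B" using Lp_seminorm_nonneg[of p M f] Lp_seminorm_nonneg[of q M g] by linarith+
    have "(LINT x|M. norm (f x) * norm (g x)) / (?A * ?B) = (LINT x|M. (norm (f x) / ?A) * (norm (g x) / ?B))"
      by simp
    also have "\<dots> \<le> (LINT x|M. norm (f x) powr p / ?A powr p / p + norm (g x) powr q / ?B powr q / q)"
    proof (rule integral_mono)
      show "integrable M (\<lambda>x. norm (f x) / ?A * (norm (g x) / ?B))"
        using Hoelder_integrable[OF f g p pq] by simp
      show "integrable M (\<lambda>x. norm (f x) powr p / ?A powr p / p + norm (g x) powr q / ?B powr q / q)"
        using Lp_funD(2)[OF f] Lp_funD(2)[OF g] by simp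
      show "norm (f x) / ?A * (norm (g x) / ?B)
          \<le> norm (f x) powr p / ?A powr p / p + norm (g x) powr q / ?B powr q / q" for x
        using Youngs_inequality[OF p q pq, of "norm (f x) / ?A" "norm (g x) / ?B"] A B
        by (simp add: powr_divide)
    qed
    also have "\<dots> = ?A powr p / ?A powr p / p + ?B powr q / ?B powr q / q"
      using Lp_funD(2)[OF f] Lp_funD(2)[OF g] p q by (simp add: Lp_seminorm_powr)
    also have "\<dots> = 1" using A B pq by simp
    finally show ?thesis using A B by (simp add: divide_simps)
  qed
qed

text \<open>The tangent inequalities at the weighted mean are added with weights \<open>u\<close>
  and \<open>v\<close>; the linear terms cancel because the weights sum to 1.\<close>

lemma powr_convex_combination:
  fixes p x y u v :: real
  assumes "1 < p" "0 \<le> x" "0 \<le> y" "0 \<le> u" "0 \<le> v" "u + v = 1"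
  shows "(u * x + v * y) powr p \<le> u * x powr p + v * y powr p"
proof -
  let ?m = "u * x + v * y"
  let ?c = "p * ?m powr (p - 1)"
  have m: "0 \<le> ?m" using assms by simp
  have "u * (?m powr p + ?c * (x - ?m)) + v * (?m powr p + ?c * (y - ?m))
      \<le> u * x powr p + v * y powr p"
    using assms m by (intro add_mono mult_left_mono powr_tangent) auto
  also have "u * (?m powr p + ?c * (x - ?m)) + v * (?m powr p + ?c * (y - ?m))
      = (u + v) * ?m powr p + ?c * (?m - (u + v) * ?m)"
    by (simp add: algebra_simps)
  finally show ?thesis using assms by simp
qed

text \<open>With \<open>?A\<close> and \<open>?B\<close> the two seminorms,
  \<open>(|f| + |g|) / (?A + ?B)\<close> is a convex combination of \<open>|f| / ?A\<close> and
  \<open>|g| / ?B\<close> with weights proportional to \<open>?A\<close> and \<open>?B\<close>.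
  Convexity of the power bounds its p-th power integral by 1.\<close>

lemma Minkowski_inequality:
  assumes f: "f \<in> Lp_fun p M" and g: "g \<in> Lp_fun p M" and p: "1 < p"
  shows "Lp_seminorm p M (\<lambda>x. f x + g x) \<le> Lp_seminorm p M f + Lp_seminorm p M g"
proof -
  note [measurable] = Lp_funD(1)[OF f] Lp_funD(1)[OF g]
  let ?A = "Lp_seminorm p M f" and ?B = "Lp_seminorm p M g"
  consider "?A = 0" | "?B = 0" | "0 < ?A" "0 < ?B"
    using Lp_seminorm_nonneg[of p M f] Lp_seminorm_nonneg[of p M g] by linarith
  then show ?thesis
  proof cases
    case 1
    then have "Lp_seminorm p M (\<lambda>x. f x + g x) = ?B"
      using Lp_seminorm_eq_0_AE[OF f] by (intro Lp_seminorm_cong_AE) (auto elim: eventually_mono)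
    then show ?thesis using 1 by simp
  next
    case 2
    then have "Lp_seminorm p M (\<lambda>x. f x + g x) = ?A"
      using Lp_seminorm_eq_0_AE[OF g] by (intro Lp_seminorm_cong_AE) (auto elim: eventually_mono)
    then show ?thesis using 2 by simp
  next
    case 3
    let ?s = "?A + ?B"
    have s: "0 < ?s" using 3 by simp
    have "(LINT x|M. norm (f x + g x) powr p) / ?s powr p = (LINT x|M. norm (f x + g x) powr p / ?s powr p)"
      by simp
    also have "\<dots> \<le> (LINT x|M. ?A / ?s * (norm (f x) powr p / ?A powr p) + ?B / ?s * (norm (g x) powr p / ?B powr p))"
    proof (rule integral_mono)
      show "integrable M (\<lambda>x. norm (f x + g x) powr p / ?s powr p)"
        using Lp_funD(2)[OF Lp_fun_add[OF f g p]] by simp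
      show "integrable M (\<lambda>x. ?A / ?s * (norm (f x) powr p / ?A powr p) + ?B / ?s * (norm (g x) powr p / ?B powr p))"
        using Lp_funD(2)[OF f] Lp_funD(2)[OF g] by simp
      fix x
      have "norm (f x + g x) powr p / ?s powr p = (norm (f x + g x) / ?s) powr p"
        by (simp add: powr_divide)
      also have "\<dots> \<le> ((norm (f x) + norm (g x)) / ?s) powr p"
        using s p by (intro powr_mono2 divide_right_mono norm_triangle_ineq) auto
      also have "(norm (f x) + norm (g x)) / ?s = ?A / ?s * (norm (f x) / ?A) + ?B / ?s * (norm (g x) / ?B)"
        using 3 by (simp add: add_divide_distrib)
      also have "(?A / ?s * (norm (f x) / ?A) + ?B / ?s * (norm (g x) / ?B)) powr p
          \<le> ?A / ?s * (norm (f x) / ?A) powr p + ?B / ?s * (norm (g x) / ?B) powr p"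
        using 3 s p by (intro powr_convex_combination) (auto simp flip: add_divide_distrib)
      finally show "norm (f x + g x) powr p / ?s powr p
          \<le> ?A / ?s * (norm (f x) powr p / ?A powr p) + ?B / ?s * (norm (g x) powr p / ?B powr p)"
        by (simp add: powr_divide)
    qed
    also have "\<dots> = ?A / ?s * (?A powr p / ?A powr p) + ?B / ?s * (?B powr p / ?B powr p)"
      using Lp_funD(2)[OF f] Lp_funD(2)[OF g] p by (simp add: Lp_seminorm_powr)
    also have "\<dots> = 1" using 3 s by (simp flip: add_divide_distrib)
    finally have "(LINT x|M. norm (f x + g x) powr p) \<le> ?s powr p"
      using s by (simp add: divide_simps)
    then have "Lp_seminorm p M (\<lambda>x. f x + g x) \<le> (?s powr p) powr (1 / p)"
      unfolding Lp_seminorm_def[of p M "\<lambda>x. f x + g x"] using p by (intro powr_mono2) auto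
    also have "\<dots> = ?s" using s p by (simp add: powr_powr)
    finally show ?thesis .
  qed
qed

text \<open>The Riesz-Fischer argument: a rapidly Cauchy subsequence converges almost everywhere by
  Markov and Borel-Cantelli, and Fatou's lemma shows that the whole sequence converges to its limit
  in \<open>L^p\<close>.\<close>

lemma Lp_complete:
  fixes f :: "nat \<Rightarrow> 'a \<Rightarrow> complex"
  assumes p: "1 < p" and f: "\<And>n. f n \<in> Lp_fun p M"
    and Cauchy: "\<And>e. 0 < e \<Longrightarrow> \<exists>N. \<forall>m\<ge>N. \<forall>n\<ge>N. (LINT x|M. norm (f m x - f n x) powr p) \<le> e"
  obtains g where "g \<in> Lp_fun p M" "(\<lambda>n. LINT x|M. norm (f n x - g x) powr p) \<longlonglongrightarrow> 0"
proof -
  note [measurable] = Lp_funD(1)[OF f]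
  have diff: "(\<lambda>x. f m x - f n x) \<in> Lp_fun p M" for m n
    by (rule Lp_fun_diff[OF f f p])
  \<comment> \<open>The p-th power of the threshold \<open>(1/2)^k\<close>. Requiring integrals
    below \<open>(1/2)^k * c k\<close> leaves measure at most \<open>(1/2)^k\<close>, a summable
    bound, for the set where an increment reaches the threshold.\<close>
  define c where "c k = ((1/2) ^ k) powr p" for k :: nat
  have c: "0 < c k" for k by (simp add: c_def)
  have "\<exists>N. \<forall>m\<ge>N. \<forall>n\<ge>N. (LINT x|M. norm (f m x - f n x) powr p) \<le> (1/2) ^ k * c k" for k
    using c by (intro Cauchy) simp
  then obtain N where N: "\<And>k m n. N k \<le> m \<Longrightarrow> N k \<le> n \<Longrightarrow>
      (LINT x|M. norm (f m x - f n x) powr p) \<le> (1/2) ^ k * c k"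
    by metis
  \<comment> \<open>The sum puts both \<open>r k\<close> and \<open>r (Suc k)\<close> beyond
    \<open>N k\<close>; the summand \<open>k\<close> makes the indices tend to infinity.\<close>
  define r where "r k = k + (\<Sum>j\<le>k. N j)" for k
  have r: "N k \<le> r k" "N k \<le> r (Suc k)" "k \<le> r k" for k
    using member_le_sum[of k "{..k}" N] by (auto simp: r_def)
  define A where "A k = {x \<in> space M. c k \<le> norm (f (r (Suc k)) x - f (r k) x) powr p}" for k
  have A_le: "emeasure M (A k) \<le> ennreal ((1/2) ^ k)" for k
  proof -
    have "emeasure M (A k) \<le> ennreal (1 / c k * (LINT x|M. norm (f (r (Suc k)) x - f (r k) x) powr p))"
      unfolding A_def using Lp_funD(2)[OF diff] c by (intro integral_Markov_inequality) auto
    also have "\<dots> \<le> ennreal (1 / c k * ((1/2) ^ k * c k))"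
      using N[OF r(2,1)] c[of k] by (intro ennreal_leI mult_left_mono) auto
    finally show ?thesis using c[of k] by simp
  qed
  have "AE x in M. eventually (\<lambda>k. x \<in> space M - A k) sequentially"
  proof (rule borel_cantelli_AE1)
    show "A k \<in> sets M" for k unfolding A_def by measurable
    show "emeasure M (A k) < \<infinity>" for k
      using A_le[of k] by (auto intro: le_less_trans)
    have "measure M (A k) \<le> (1/2) ^ k" for k
      using A_le[of k] by (simp add: measure_def enn2real_leI)
    then show "summable (\<lambda>k. measure M (A k))"
      by (intro summable_comparison_test'[OF summable_geometric[of "1/2"], of 0]) auto
  qed
  then have conv: "AE x in M. convergent (\<lambda>k. f (r k) x)"
  proof eventually_elim
    case (elim x)
    then obtain k0 where "\<And>k. k0 \<le> k \<Longrightarrow> norm (f (r (Suc k)) x - f (r k) x) powr p < c k"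
      by (auto simp: A_def eventually_sequentially not_le)
    then have "norm (f (r (Suc k)) x - f (r k) x) \<le> (1/2) ^ k" if "k0 \<le> k" for k
      using that p powr_mono2[of p "(1/2) ^ k" "norm (f (r (Suc k)) x - f (r k) x)"]
      by (force simp: c_def)
    then have "summable (\<lambda>k. f (r (Suc k)) x - f (r k) x)"
      by (intro summable_comparison_test'[OF summable_geometric[of "1/2"], of k0]) auto
    then have "convergent (\<lambda>n. \<Sum>k<n. f (r (Suc k)) x - f (r k) x)"
      by (simp add: summable_iff_convergent)
    then have "convergent (\<lambda>n. f (r n) x - f (r 0) x)"
      by (simp add: sum_lessThan_telescope[of "\<lambda>k. f (r k) x"])
    then show ?case by (simp add: convergent_diff_const_right_iff)
  qed
  \<comment> \<open>On the null set without convergence \<open>lim\<close> has a default value,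
    which does not affect the almost everywhere statements.\<close>
  define g where "g x = lim (\<lambda>k. f (r k) x)" for x
  have [measurable]: "g \<in> borel_measurable M"
    unfolding g_def by measurable
  have lim: "AE x in M. (\<lambda>k. f (r k) x) \<longlonglongrightarrow> g x"
    using conv by eventually_elim (simp add: g_def convergent_LIMSEQ_iff)
  \<comment> \<open>For fixed \<open>m\<close>, Fatou's lemma along the subsequence carries the
    Cauchy bound over from \<open>f n\<close> to \<open>g\<close>.\<close>
  have close: "(\<lambda>x. f m x - g x) \<in> Lp_fun p M \<and> (LINT x|M. norm (f m x - g x) powr p) \<le> e"
    if e: "0 < e" and n: "\<And>n. n0 \<le> n \<Longrightarrow> (LINT x|M. norm (f m x - f n x) powr p) \<le> e" for m n0 e
  proof -
    have "(\<integral>\<^sup>+x. ennreal (norm (f m x - g x) powr p) \<partial>M)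
        = (\<integral>\<^sup>+x. liminf (\<lambda>k. ennreal (norm (f m x - f (r k) x) powr p)) \<partial>M)"
    proof (rule nn_integral_cong_AE, use lim in eventually_elim)
      case (elim x)
      have "(\<lambda>k. norm (f m x - f (r k) x) powr p) \<longlonglongrightarrow> norm (f m x - g x) powr p"
        using p elim by (intro tendsto_powr' tendsto_intros) auto
      then have "(\<lambda>k. ennreal (norm (f m x - f (r k) x) powr p)) \<longlonglongrightarrow> ennreal (norm (f m x - g x) powr p)"
        by (rule tendsto_ennrealI)
      then show ?case by (intro lim_imp_Liminf[symmetric]) auto
    qed
    also have "\<dots> \<le> liminf (\<lambda>k. \<integral>\<^sup>+x. ennreal (norm (f m x - f (r k) x) powr p) \<partial>M)"
      by (rule nn_integral_liminf) measurable
    also have "\<dots> \<le> ennreal e"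
    proof (rule Liminf_le)
      show "\<forall>\<^sub>F k in sequentially. (\<integral>\<^sup>+x. ennreal (norm (f m x - f (r k) x) powr p) \<partial>M) \<le> ennreal e"
        unfolding eventually_sequentially
      proof (intro exI allI impI)
        fix k assume "n0 \<le> k"
        then have "n0 \<le> r k" using r(3) le_trans by blast
        then show "(\<integral>\<^sup>+x. ennreal (norm (f m x - f (r k) x) powr p) \<partial>M) \<le> ennreal e"
          using n Lp_funD(2)[OF diff] by (subst nn_integral_eq_integral) (auto intro: ennreal_leI)
      qed
    qed simp
    finally have le: "(\<integral>\<^sup>+x. ennreal (norm (f m x - g x) powr p) \<partial>M) \<le> ennreal e" .
    then have int: "integrable M (\<lambda>x. norm (f m x - g x) powr p)"
      by (intro integrableI_bounded) (auto intro: le_less_trans)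
    moreover have "(LINT x|M. norm (f m x - g x) powr p) \<le> e"
      using le e by (subst (asm) nn_integral_eq_integral[OF int]) auto
    ultimately show ?thesis by (simp add: Lp_fun_def)
  qed
  have ev: "\<exists>N. \<forall>m\<ge>N. (\<lambda>x. f m x - g x) \<in> Lp_fun p M \<and> (LINT x|M. norm (f m x - g x) powr p) \<le> e"
    if "0 < e" for e
    using Cauchy[OF that] close[OF that] by metis
  show ?thesis
  proof
    obtain m where "(\<lambda>x. f m x - g x) \<in> Lp_fun p M" using ev[of 1] by auto
    from Lp_fun_diff[OF f[of m] this p] show "g \<in> Lp_fun p M" by simp
    show "(\<lambda>n. LINT x|M. norm (f n x - g x) powr p) \<longlonglongrightarrow> 0"
    proof (rule LIMSEQ_I)
      fix e :: real assume "0 < e"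
      then obtain N where "\<forall>m\<ge>N. (LINT x|M. norm (f m x - g x) powr p) \<le> e / 2"
        using ev[of "e / 2"] by auto
      then show "\<exists>N. \<forall>n\<ge>N. norm ((LINT x|M. norm (f n x - g x) powr p) - 0) < e"
        using \<open>0 < e\<close> by (intro exI[of _ N]) fastforce
    qed
  qed
qed

subsection \<open>Functionals on subspaces of Lebesgue spaces\<close>

lemma duality_map_Lp:
  assumes f: "f \<in> Lp_fun p M" and p: "1 < p" and pq: "1 / p + 1 / q = 1"
  shows "(\<lambda>x. duality_map p (f x)) \<in> Lp_fun q M"
proof -
  have [measurable]: "duality_map p \<in> borel_measurable (borel :: complex measure)"
    by (intro borel_measurable_continuous_onI continuous_duality_map p)
  show ?thesis
    using Lp_funD[OF f] conjugate_exponent(2)[OF p pq]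
    by (simp add: Lp_fun_def norm_duality_map powr_powr)
qed

lemma inner_complex_eq: "x \<bullet> y = Re (x * cnj y)"
  by (simp add: inner_complex_def)

text \<open>After taking p-th roots this is the reverse triangle inequality for the
  seminorm.\<close>

lemma Lp_integral_norm_powr_tendsto:
  assumes f: "\<And>n. f n \<in> Lp_fun p M" and g: "g \<in> Lp_fun p M" and p: "1 < p"
    and lim: "(\<lambda>n. LINT x|M. norm (f n x - g x) powr p) \<longlonglongrightarrow> 0"
  shows "(\<lambda>n. LINT x|M. norm (f n x) powr p) \<longlonglongrightarrow> (LINT x|M. norm (g x) powr p)"
proof -
  have d: "(\<lambda>n. Lp_seminorm p M (\<lambda>x. f n x - g x)) \<longlonglongrightarrow> 0"
    using tendsto_powr'[OF lim tendsto_const, of "1 / p"] p by (simp add: Lp_seminorm_def)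
  have "(\<lambda>n. Lp_seminorm p M (f n)) \<longlonglongrightarrow> Lp_seminorm p M g"
  proof (rule LIM_zero_cancel, rule Lim_null_comparison[OF always_eventually d], rule allI)
    fix n
    have "Lp_seminorm p M (f n) \<le> Lp_seminorm p M g + Lp_seminorm p M (\<lambda>x. f n x - g x)"
      using Minkowski_inequality[OF g Lp_fun_diff[OF f[of n] g p] p] by simp
    moreover have "Lp_seminorm p M g \<le> Lp_seminorm p M (f n) + Lp_seminorm p M (\<lambda>x. g x - f n x)"
      using Minkowski_inequality[OF f[of n] Lp_fun_diff[OF g f[of n] p] p] by simp
    moreover have "Lp_seminorm p M (\<lambda>x. g x - f n x) = Lp_seminorm p M (\<lambda>x. f n x - g x)"
      by (simp add: Lp_seminorm_def norm_minus_commute)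
    ultimately show "norm (Lp_seminorm p M (f n) - Lp_seminorm p M g) \<le> Lp_seminorm p M (\<lambda>x. f n x - g x)"
      by simp
  qed
  then have "(\<lambda>n. Lp_seminorm p M (f n) powr p) \<longlonglongrightarrow> Lp_seminorm p M g powr p"
    using p by (intro tendsto_powr' tendsto_const) (auto simp: Lp_seminorm_nonneg)
  then show ?thesis using p by (simp add: Lp_seminorm_powr)
qed

lemma borel_measurable_cnj [measurable]:
  assumes "f \<in> borel_measurable M"
  shows "(\<lambda>x. cnj (f x)) \<in> borel_measurable M"
  using assms by (rule borel_measurable_continuous_on[OF continuous_on_cnj[OF continuous_on_id]])

lemma Lp_pairing_integrable:
  assumes f: "f \<in> Lp_fun p M" and g: "g \<in> Lp_fun q M" and p: "1 < p" and pq: "1 / p + 1 / q = 1"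
  shows "integrable M (\<lambda>x. f x * cnj (g x))"
proof -
  note [measurable] = Lp_funD(1)[OF f] Lp_funD(1)[OF g]
  show ?thesis
    by (rule Bochner_Integration.integrable_bound[OF Hoelder_integrable[OF f g p pq]])
       (auto simp: norm_mult)
qed

lemma Lp_pairing_norm_le:
  assumes f: "f \<in> Lp_fun p M" and g: "g \<in> Lp_fun q M" and p: "1 < p" and pq: "1 / p + 1 / q = 1"
  shows "norm (LINT x|M. f x * cnj (g x)) \<le> Lp_seminorm p M f * Lp_seminorm q M g"
proof -
  have "norm (LINT x|M. f x * cnj (g x)) \<le> (LINT x|M. norm (f x * cnj (g x)))"
    by (rule integral_norm_bound)
  also have "\<dots> \<le> Lp_seminorm p M f * Lp_seminorm q M g"
    using Hoelder_inequality[OF assms] by (simp add: norm_mult)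
  finally show ?thesis .
qed

text \<open>\<open>V\<close> is not assumed closed, so minimality is exploited along the minimising
  sequence inside \<open>V\<close>, and the limit is taken only in the resulting
  inequalities.\<close>

proposition Lp_subspace_functional_representation:
  fixes V :: "('a \<Rightarrow> complex) set" and l :: "('a \<Rightarrow> complex) \<Rightarrow> complex"
  assumes p: "1 < p" and pq: "1 / p + 1 / q = 1"
    and V: "V \<subseteq> Lp_fun p M" "V \<noteq> {}"
    and V_add: "\<And>f g. f \<in> V \<Longrightarrow> g \<in> V \<Longrightarrow> (\<lambda>x. f x + g x) \<in> V"
    and V_cmult: "\<And>c f. f \<in> V \<Longrightarrow> (\<lambda>x. c * f x) \<in> V"
    and l_add: "\<And>f g. f \<in> V \<Longrightarrow> g \<in> V \<Longrightarrow> l (\<lambda>x. f x + g x) = l f + l g"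
    and l_cmult: "\<And>c f. f \<in> V \<Longrightarrow> l (\<lambda>x. c * f x) = c * l f"
    and l_bound: "\<And>f. f \<in> V \<Longrightarrow> norm (l f) \<le> C * Lp_seminorm p M f"
  obtains g where "g \<in> Lp_fun q M" "\<And>f. f \<in> V \<Longrightarrow> l f = (LINT x|M. f x * cnj (g x))"
proof -
  define S where "S f = (LINT x|M. norm (f x :: complex) powr p)" for f
  define J where "J f = S f / p - Re (l f)" for f
  have VL: "f \<in> Lp_fun p M" if "f \<in> V" for f using V that by auto
  have S_nonneg: "0 \<le> S f" for f by (simp add: S_def)
  have q: "1 < q" using conjugate_exponent[OF p pq] by simp
  \<comment> \<open>The remainder in Young's inequality for \<open>C * ?N\<close>. The factor
    \<open>2 powr (1 / p)\<close> is moved between the two factors so that only half of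
    \<open>S f / p\<close> is spent.\<close>
  define B where "B = (2 powr (1 / p) * \<bar>C\<bar>) powr q / q"
  have l_le: "Re (l f) \<le> S f / (2 * p) + B" if "f \<in> V" for f
  proof -
    let ?N = "Lp_seminorm p M f"
    have "Re (l f) \<le> norm (l f)" by (rule complex_Re_le_cmod)
    also have "\<dots> \<le> C * ?N" using l_bound[OF that] .
    also have "\<dots> \<le> \<bar>C\<bar> * ?N" by (intro mult_right_mono) (auto simp: Lp_seminorm_nonneg)
    also have "\<dots> = (?N / 2 powr (1 / p)) * (2 powr (1 / p) * \<bar>C\<bar>)" by simp
    also have "\<dots> \<le> (?N / 2 powr (1 / p)) powr p / p + B"
      unfolding B_def by (intro Youngs_inequality p q pq) (auto simp: Lp_seminorm_nonneg)
    also have "(?N / 2 powr (1 / p)) powr p = S f / 2"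
      using p by (simp add: powr_divide Lp_seminorm_powr powr_powr S_def)
    finally show ?thesis by simp
  qed
  \<comment> \<open>Coercivity: the other half of \<open>S f / p\<close> bounds \<open>S\<close> by
    \<open>J\<close>. Hence \<open>J\<close> is bounded below and minimising sequences are bounded
    in \<open>L^p\<close>.\<close>
  have S_le: "S f \<le> 2 * p * (J f + B)" if "f \<in> V" for f
  proof -
    have "2 * p * Re (l f) \<le> S f + 2 * p * B"
      using l_le[OF that] p by (simp add: field_simps)
    moreover have "2 * p * (J f + B) = 2 * S f - 2 * p * Re (l f) + 2 * p * B"
      using p by (simp add: J_def algebra_simps)
    ultimately show ?thesis by linarith
  qed
  have J_ge: "- B \<le> J f" if "f \<in> V" for f
  proof -
    have "0 \<le> 2 * p * (J f + B)" using S_le[OF that] S_nonneg[of f] by linarith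
    then show ?thesis using p by (simp add: zero_le_mult_iff)
  qed
  define m where "m = (INF f\<in>V. J f)"
  have bdd: "bdd_below (J ` V)" using J_ge by (auto intro!: bdd_belowI)
  have m_le: "m \<le> J f" if "f \<in> V" for f
    unfolding m_def using bdd that by (rule cINF_lower)
  have "\<exists>f\<in>V. J f < m + 1 / real (Suc n)" for n
    using V(2) bdd cINF_less_iff[of V J "m + 1 / real (Suc n)"] by (simp add: m_def)
  then obtain f where fV: "\<And>n. f n \<in> V" and f: "\<And>n. J (f n) < m + 1 / real (Suc n)"
    by metis
  note fL = VL[OF fV]
  define R where "R = 2 * p * (m + 1 + B)"
  have S_R: "S (f n) \<le> R" for n
  proof -
    have "J (f n) \<le> m + 1" using f[of n] by (simp add: order_trans[OF less_imp_le[OF f]])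
    then show ?thesis using S_le[OF fV[of n]] p unfolding R_def
      by (intro order_trans[OF S_le[OF fV]] mult_left_mono) auto
  qed
  have "0 \<le> R" using S_R[of 0] S_nonneg[of "f 0"] by linarith
  \<comment> \<open>The midpoint lies in \<open>V\<close>, so \<open>J\<close> is at least
    \<open>m\<close> there, while both endpoints exceed \<open>m\<close> by at most
    \<open>1 / real (Suc N)\<close>. The linear part of \<open>J\<close> cancels, leaving the
    convexity defect of \<open>S\<close>.\<close>
  have midpoint: "(S (f i) + S (f j)) / 2 - S (\<lambda>x. (1/2) * (f i x + f j x)) \<le> p / real (Suc N)"
    if "N \<le> i" "N \<le> j" for i j N
  proof -
    let ?h = "\<lambda>x. (1/2) * (f i x + f j x)"
    have h: "?h \<in> V" by (intro V_cmult V_add fV)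
    have le: "1 / real (Suc i) \<le> 1 / real (Suc N)" "1 / real (Suc j) \<le> 1 / real (Suc N)"
      using that by (auto simp: frac_le)
    have "J (f i) \<le> m + 1 / real (Suc N)" "J (f j) \<le> m + 1 / real (Suc N)"
      using f[of i] f[of j] le by linarith+
    moreover have "m \<le> J ?h" by (rule m_le[OF h])
    moreover have "l ?h = (1/2) * (l (f i) + l (f j))"
      by (simp only: l_cmult[OF V_add[OF fV fV]] l_add[OF fV fV])
    ultimately have "(S (f i) + S (f j)) / 2 / p - S ?h / p \<le> 1 / real (Suc N)"
      by (simp add: J_def add_divide_distrib)
    then have "p * ((S (f i) + S (f j)) / 2 / p - S ?h / p) \<le> p * (1 / real (Suc N))"
      using p by (intro mult_left_mono) auto
    then show ?thesis using p by (simp add: right_diff_distrib)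
  qed
  have Cauchy: "\<exists>N. \<forall>i\<ge>N. \<forall>j\<ge>N. (LINT x|M. norm (f i x - f j x) powr p) \<le> e" if e: "0 < e" for e
  proof -
    \<comment> \<open>The first term of the convexity estimate then contributes at most half of
      \<open>e\<close>; \<open>R + 1\<close> avoids division by zero. The other half comes from
      taking \<open>N\<close> large.\<close>
    define \<epsilon> where "\<epsilon> = e / (4 * (R + 1))"
    have eps: "0 < \<epsilon>" "\<epsilon> * (2 * R) \<le> e / 2" using e \<open>0 \<le> R\<close> by (auto simp: \<epsilon>_def field_simps)
    \<comment> \<open>The convexity defect of the integrals is controlled by the gap to the minimum of \<open>J\<close>.\<close>
    obtain K where K: "0 \<le> K" "\<And>a b :: complex.
      norm (a - b) powr p \<le> \<epsilon> * (norm a powr p + norm b powr p) +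
        K * ((norm a powr p + norm b powr p) / 2 - norm ((1/2) *\<^sub>R (a + b)) powr p)"
      using norm_powr_uniformly_convex[OF p eps(1)] by metis
    obtain N :: nat where N: "2 * K * p / e < real N" using reals_Archimedean2 by blast
    have KN: "K * (p / real (Suc N)) \<le> e / 2"
      using N e by (simp add: field_simps)
    have "(LINT x|M. norm (f i x - f j x) powr p) \<le> e" if ij: "N \<le> i" "N \<le> j" for i j
    proof -
      let ?h = "\<lambda>x. (1/2) * (f i x + f j x)"
      have hL: "?h \<in> Lp_fun p M" by (intro VL V_cmult V_add fV)
      note ints = Lp_funD(2)[OF fL] Lp_funD(2)[OF hL] Lp_funD(2)[OF Lp_fun_diff[OF fL fL p]]
      have "(LINT x|M. norm (f i x - f j x) powr p) \<le>
          (LINT x|M. \<epsilon> * (norm (f i x) powr p + norm (f j x) powr p) +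
            K * ((norm (f i x) powr p + norm (f j x) powr p) / 2 - norm (?h x) powr p))"
      proof (rule integral_mono)
        show "norm (f i x - f j x) powr p \<le> \<epsilon> * (norm (f i x) powr p + norm (f j x) powr p) +
            K * ((norm (f i x) powr p + norm (f j x) powr p) / 2 - norm (?h x) powr p)" for x
          using K(2)[of "f i x" "f j x"] by (simp add: scaleR_conv_of_real)
      qed (intro Bochner_Integration.integrable_add Bochner_Integration.integrable_diff
             integrable_mult_right integrable_divide ints)+
      also have "\<dots> = \<epsilon> * (S (f i) + S (f j)) + K * ((S (f i) + S (f j)) / 2 - S ?h)"
        unfolding S_def using ints by simp
      also have "\<dots> \<le> \<epsilon> * (2 * R) + K * (p / real (Suc N))"
        using S_R[of i] S_R[of j] eps K midpoint[OF ij] by (intro add_mono mult_left_mono) auto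
      also have "\<dots> \<le> e" using eps KN by linarith
      finally show ?thesis .
    qed
    then show ?thesis by blast
  qed
  obtain f0 where f0: "f0 \<in> Lp_fun p M"
    and lim: "(\<lambda>n. LINT x|M. norm (f n x - f0 x) powr p) \<longlonglongrightarrow> 0"
    using Lp_complete[OF p fL Cauchy] by blast
  \<comment> \<open>\<open>J\<close> is compared at \<open>f n\<close> and \<open>f n + t h\<close>,
    both in \<open>V\<close>, with \<open>J (f n)\<close> within \<open>1 / real (Suc n)\<close> of
    \<open>m\<close>. As \<open>n\<close> grows, \<open>m\<close> cancels and only integrals
    involving \<open>f0\<close> remain, so \<open>l\<close> is never evaluated at
    \<open>f0\<close>.\<close>
  have variation: "t * Re (l h) \<le> (S (\<lambda>x. f0 x + of_real t * h x) - S f0) / p" if h: "h \<in> V" for h t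
  proof -
    have th: "(\<lambda>x. of_real t * h x) \<in> V" by (rule V_cmult[OF h])
    have S_lim: "(\<lambda>n. S (\<lambda>x. f n x + of_real t * h x)) \<longlonglongrightarrow> S (\<lambda>x. f0 x + of_real t * h x)"
      unfolding S_def
      by (rule Lp_integral_norm_powr_tendsto) (use lim fL f0 VL[OF th] p in \<open>auto intro: Lp_fun_add\<close>)
    have S_lim0: "(\<lambda>n. S (f n)) \<longlonglongrightarrow> S f0"
      unfolding S_def by (rule Lp_integral_norm_powr_tendsto[OF fL f0 p lim])
    have "(\<lambda>n. (S (\<lambda>x. f n x + of_real t * h x) - S (f n)) / p + (m + 1 / real (Suc n)) - t * Re (l h))
        \<longlonglongrightarrow> (S (\<lambda>x. f0 x + of_real t * h x) - S f0) / p + (m + 0) - t * Re (l h)"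
      using p by (intro tendsto_intros S_lim S_lim0 LIMSEQ_Suc[OF lim_1_over_n]) auto
    moreover have "m \<le> (S (\<lambda>x. f n x + of_real t * h x) - S (f n)) / p + (m + 1 / real (Suc n)) - t * Re (l h)" for n
    proof -
      have "m \<le> J (\<lambda>x. f n x + of_real t * h x)" by (intro m_le V_add fV th)
      also have "\<dots> = (S (\<lambda>x. f n x + of_real t * h x) - S (f n)) / p + J (f n) - t * Re (l h)"
        by (simp only: J_def l_add[OF fV th] l_cmult[OF h]) (simp add: diff_divide_distrib)
      finally show ?thesis using f[of n] by linarith
    qed
    ultimately have "m \<le> (S (\<lambda>x. f0 x + of_real t * h x) - S f0) / p + (m + 0) - t * Re (l h)"
      by (intro LIMSEQ_le_const) auto
    then show ?thesis by simp
  qed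
  define g where "g x = duality_map p (f0 x)" for x
  have gL: "g \<in> Lp_fun q M" unfolding g_def by (rule duality_map_Lp[OF f0 p pq])
  \<comment> \<open>The tangent inequality is taken at the perturbed point \<open>u t\<close>, not
    at \<open>f0\<close>, because an upper bound for \<open>S (u t) - S f0\<close> is wanted.
    Dividing by \<open>t > 0\<close> and letting \<open>t\<close> tend to 0 gives the first
    variation.\<close>
  have Re_le: "Re (l h) \<le> Re (LINT x|M. h x * cnj (g x))" if h: "h \<in> V" for h
  proof -
    note hL = VL[OF h]
    note [measurable] = Lp_funD(1)[OF f0] Lp_funD(1)[OF hL]
    have [measurable]: "duality_map p \<in> borel_measurable (borel :: complex measure)"
      by (intro borel_measurable_continuous_onI continuous_duality_map p)
    define u where "u t x = f0 x + of_real t * h x" for t x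
    have uL: "u t \<in> Lp_fun p M" for t
      unfolding u_def by (intro Lp_fun_add f0 Lp_fun_cmult hL p)
    have [measurable]: "u t \<in> borel_measurable M" for t by (rule Lp_funD(1)[OF uL])
    have int: "integrable M (\<lambda>x. h x \<bullet> duality_map p (u t x))" for t
      using Lp_pairing_integrable[OF hL duality_map_Lp[OF uL p pq] p pq, THEN integrable_Re]
      by (simp add: inner_complex_eq)
    have le: "Re (l h) \<le> (LINT x|M. h x \<bullet> duality_map p (u t x))" if t: "0 < t" for t
    proof -
      have "(LINT x|M. norm (u t x) powr p + p * (- t * (h x \<bullet> duality_map p (u t x)))) \<le> S f0"
        unfolding S_def
      proof (rule integral_mono)
        show "integrable M (\<lambda>x. norm (u t x) powr p + p * (- t * (h x \<bullet> duality_map p (u t x))))"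
          using int Lp_funD(2)[OF uL] by simp
        show "integrable M (\<lambda>x. norm (f0 x) powr p)" by (rule Lp_funD(2)[OF f0])
        fix x
        have "f0 x - u t x = (- t) *\<^sub>R h x" by (simp add: u_def scaleR_conv_of_real)
        then show "norm (u t x) powr p + p * (- t * (h x \<bullet> duality_map p (u t x))) \<le> norm (f0 x) powr p"
          using norm_powr_tangent[OF p, of "u t x" "f0 x"] by simp
      qed
      then have "S (u t) - p * (t * (LINT x|M. h x \<bullet> duality_map p (u t x))) \<le> S f0"
        using int Lp_funD(2)[OF uL] by (simp add: S_def)
      then have "(S (u t) - S f0) / p \<le> t * (LINT x|M. h x \<bullet> duality_map p (u t x))"
        using p by (simp add: field_simps)
      with variation[OF h, of t] have "t * Re (l h) \<le> t * (LINT x|M. h x \<bullet> duality_map p (u t x))"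
        unfolding u_def by linarith
      then show ?thesis using t by simp
    qed
    have "(\<lambda>n. LINT x|M. h x \<bullet> duality_map p (u (1 / real (Suc n)) x))
        \<longlonglongrightarrow> (LINT x|M. h x \<bullet> duality_map p (f0 x))"
    proof (rule integral_dominated_convergence)
      \<comment> \<open>Since \<open>t \<le> 1\<close>, both \<open>norm (u t x)\<close> and
        \<open>norm (h x)\<close> are at most \<open>norm (?w x)\<close>, so its p-th power
        dominates all integrands.\<close>
      let ?w = "\<lambda>x. complex_of_real (norm (f0 x)) + complex_of_real (norm (h x))"
      show "integrable M (\<lambda>x. norm (?w x) powr p)"
        by (intro Lp_funD(2) Lp_fun_add Lp_fun_norm f0 hL p)
      show "AE x in M. (\<lambda>n. h x \<bullet> duality_map p (u (1 / real (Suc n)) x)) \<longlonglongrightarrow> h x \<bullet> duality_map p (f0 x)"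
      proof (rule AE_I2)
        fix x
        have "(\<lambda>n. f0 x + of_real (1 / real (Suc n)) * h x) \<longlonglongrightarrow> f0 x + of_real 0 * h x"
          by (intro tendsto_intros LIMSEQ_Suc[OF lim_1_over_n])
        then have "(\<lambda>n. u (1 / real (Suc n)) x) \<longlonglongrightarrow> f0 x" by (simp add: u_def)
        moreover have "isCont (duality_map p) (f0 x)"
          using continuous_duality_map[OF p, where 'a = complex] by (simp add: continuous_on_eq_continuous_at)
        ultimately show "(\<lambda>n. h x \<bullet> duality_map p (u (1 / real (Suc n)) x)) \<longlonglongrightarrow> h x \<bullet> duality_map p (f0 x)"
          by (rule tendsto_inner[OF tendsto_const isCont_tendsto_compose, rotated])
      qed
      fix n
      show "AE x in M. norm (h x \<bullet> duality_map p (u (1 / real (Suc n)) x)) \<le> norm (?w x) powr p"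
      proof (rule AE_I2)
        fix x
        have w: "norm (?w x) = norm (f0 x) + norm (h x)"
          by (simp flip: of_real_add)
        have "norm (u (1 / real (Suc n)) x) \<le> norm (f0 x) + 1 / real (Suc n) * norm (h x)"
          unfolding u_def by (rule order_trans[OF norm_triangle_ineq]) (simp only: norm_mult norm_of_real, simp)
        also have "\<dots> \<le> norm (?w x)"
          unfolding w by (intro add_left_mono mult_left_le_one_le) auto
        finally have u_le: "norm (u (1 / real (Suc n)) x) \<le> norm (?w x)" .
        have "norm (h x \<bullet> duality_map p (u (1 / real (Suc n)) x))
            \<le> norm (h x) * norm (u (1 / real (Suc n)) x) powr (p - 1)"
          using Cauchy_Schwarz_ineq2[of "h x" "duality_map p (u (1 / real (Suc n)) x)"]
          by (simp add: norm_duality_map)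
        also have "\<dots> \<le> norm (?w x) * norm (?w x) powr (p - 1)"
          using u_le p w by (intro mult_mono powr_mono2) auto
        also have "\<dots> = norm (?w x) powr p" by (simp add: powr_mult_base)
        finally show "norm (h x \<bullet> duality_map p (u (1 / real (Suc n)) x)) \<le> norm (?w x) powr p" .
      qed
    qed measurable
    then have "Re (l h) \<le> (LINT x|M. h x \<bullet> duality_map p (f0 x))"
      by (rule LIMSEQ_le_const) (use le in auto)
    also have "\<dots> = Re (LINT x|M. h x * cnj (g x))"
      unfolding inner_complex_eq g_def[symmetric]
      by (rule integral_Re[OF Lp_pairing_integrable[OF hL gL p pq]])
    finally show ?thesis .
  qed
  \<comment> \<open>Passing to \<open>-h\<close> turns the inequality into an equality of real
    parts; passing to \<open>i h\<close> afterwards gives the imaginary parts.\<close>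
  have Re_eq: "Re (l h) = Re (LINT x|M. h x * cnj (g x))" if h: "h \<in> V" for h
  proof (rule antisym)
    show "Re (l h) \<le> Re (LINT x|M. h x * cnj (g x))" by (rule Re_le[OF h])
    show "Re (LINT x|M. h x * cnj (g x)) \<le> Re (l h)"
      using Re_le[OF V_cmult[OF h, of "-1"]] l_cmult[OF h, of "-1"] by simp
  qed
  have "l h = (LINT x|M. h x * cnj (g x))" if h: "h \<in> V" for h
  proof (rule complex_eqI)
    show "Re (l h) = Re (LINT x|M. h x * cnj (g x))" by (rule Re_eq[OF h])
    show "Im (l h) = Im (LINT x|M. h x * cnj (g x))"
      using Re_eq[OF V_cmult[OF h, of \<i>]] l_cmult[OF h, of \<i>] by (simp add: mult.assoc)
  qed
  with gL show ?thesis by (rule that)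
qed

subsection \<open>Adjoints of integral kernels\<close>

lemma Lp_fun_indicator:
  assumes "finite_measure M" "A \<in> sets M"
  shows "(\<lambda>x. indicator A x) \<in> Lp_fun p M"
proof -
  interpret finite_measure M by fact
  have "(\<lambda>x. norm (indicator A x :: complex) powr p) = indicator A"
    by (auto simp: indicator_def fun_eq_iff)
  then show ?thesis using assms(2) by (simp add: Lp_fun_def emeasure_eq_measure)
qed

context
  fixes M :: "'a measure" and K :: "'a \<Rightarrow> 'a \<Rightarrow> complex" and p q C :: real
  assumes fin: "finite_measure M"
    and K [measurable]: "(\<lambda>(z, w). K z w) \<in> borel_measurable (M \<Otimes>\<^sub>M M)"
    and p: "1 < p" and pq: "1 / p + 1 / q = 1"
    and abs_integrable: "\<And>f. f \<in> Lp_fun p M \<Longrightarrow>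
      AE z in M. integrable M (\<lambda>w. norm (K z w) * norm (f w))"
    and abs_Lp: "\<And>f. f \<in> Lp_fun p M \<Longrightarrow>
      (\<lambda>z. complex_of_real (LINT w|M. norm (K z w) * norm (f w))) \<in> Lp_fun p M"
    and abs_bound: "\<And>f. f \<in> Lp_fun p M \<Longrightarrow>
      Lp_seminorm p M (\<lambda>z. complex_of_real (LINT w|M. norm (K z w) * norm (f w))) \<le> C * Lp_seminorm p M f"
begin

text \<open>The positive operator sends \<open>|f|\<close> into \<open>L^p\<close>, so Hoelder
  against \<open>|g|\<close> makes the integrand absolutely integrable on the product. Fubini then
  moves the kernel from one side of the pairing to the other, and the same estimate bounds the
  pairing.\<close>

lemma kernel_adjoint_Fubini:
  assumes f: "f \<in> Lp_fun p M" and g: "g \<in> Lp_fun q M"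
  shows "integrable M (\<lambda>w. f w * cnj (LINT z|M. cnj (K z w) * g z))" (is ?int)
    and "(LINT w|M. f w * cnj (LINT z|M. cnj (K z w) * g z)) =
         (LINT z|M. (LINT w|M. K z w * f w) * cnj (g z))" (is ?eq)
    and "norm (LINT w|M. f w * cnj (LINT z|M. cnj (K z w) * g z)) \<le>
         C * Lp_seminorm p M f * Lp_seminorm q M g" (is ?le)
proof -
  interpret finite_measure M by (rule fin)
  interpret pair_sigma_finite M M ..
  note [measurable] = Lp_funD(1)[OF f] Lp_funD(1)[OF g]
  let ?u = "\<lambda>z. complex_of_real (LINT w|M. norm (K z w) * norm (f w))"
  let ?F = "\<lambda>z w. K z w * f w * cnj (g z)"
  have u_norm: "norm (?u z) = (LINT w|M. norm (K z w) * norm (f w))" for z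
    by (simp add: integral_nonneg_AE)
  have F: "integrable (M \<Otimes>\<^sub>M M) (\<lambda>(z, w). ?F z w)"
  proof (rule Fubini_integrable)
    show "(\<lambda>(z, w). ?F z w) \<in> borel_measurable (M \<Otimes>\<^sub>M M)" by measurable
    have "(LINT w|M. norm (case (z, w) of (z, w) \<Rightarrow> ?F z w)) = norm (?u z) * norm (g z)" for z
      unfolding u_norm by (simp add: norm_mult)
    then show "integrable M (\<lambda>z. LINT w|M. norm (case (z, w) of (z, w) \<Rightarrow> ?F z w))"
      using Hoelder_integrable[OF abs_Lp[OF f] g p pq] by simp
    show "AE z in M. integrable M (\<lambda>w. case (z, w) of (z, w) \<Rightarrow> ?F z w)"
      using abs_integrable[OF f] AE_space
    proof eventually_elim
      case (elim z)
      then have [measurable]: "K z \<in> borel_measurable M" using K by measurable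
      have "integrable M (\<lambda>w. K z w * f w)"
        by (rule Bochner_Integration.integrable_bound[OF elim(1)]) (auto simp: norm_mult)
      then show ?case by simp
    qed
  qed
  \<comment> \<open>This holds at every \<open>w\<close>: conjugation and constant factors pass
    through the integral even where it takes its default value 0.\<close>
  have inner: "f w * cnj (LINT z|M. cnj (K z w) * g z) = (LINT z|M. ?F z w)" for w
  proof -
    have "f w * cnj (LINT z|M. cnj (K z w) * g z) = f w * (LINT z|M. K z w * cnj (g z))"
      by (simp flip: Bochner_Integration.integral_cnj)
    also have "\<dots> = (LINT z|M. f w * (K z w * cnj (g z)))" by simp
    finally show ?thesis by (simp only: mult_ac)
  qed
  show ?int unfolding inner by (rule integrable_snd[OF F])
  have "(LINT w|M. f w * cnj (LINT z|M. cnj (K z w) * g z)) = (LINT z|M. LINT w|M. ?F z w)"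
    unfolding inner by (rule Fubini_integral[OF F])
  then show eq: ?eq by simp
  have "norm (LINT z|M. (LINT w|M. K z w * f w) * cnj (g z))
      \<le> (LINT z|M. norm ((LINT w|M. K z w * f w) * cnj (g z)))"
    by (rule integral_norm_bound)
  also have "\<dots> \<le> (LINT z|M. norm (?u z) * norm (g z))"
  proof (rule integral_mono)
    show "integrable M (\<lambda>z. norm ((LINT w|M. K z w * f w) * cnj (g z)))"
      using integrable_fst[OF F] by simp
    show "integrable M (\<lambda>z. norm (?u z) * norm (g z))"
      by (rule Hoelder_integrable[OF abs_Lp[OF f] g p pq])
    fix z
    have "norm (LINT w|M. K z w * f w) \<le> (LINT w|M. norm (K z w * f w))"
      by (rule integral_norm_bound)
    then show "norm ((LINT w|M. K z w * f w) * cnj (g z)) \<le> norm (?u z) * norm (g z)"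
      unfolding u_norm by (simp add: norm_mult mult_right_mono)
  qed
  also have "\<dots> \<le> Lp_seminorm p M ?u * Lp_seminorm q M g"
    by (rule Hoelder_inequality[OF abs_Lp[OF f] g p pq])
  also have "\<dots> \<le> C * Lp_seminorm p M f * Lp_seminorm q M g"
    by (intro mult_right_mono abs_bound f Lp_seminorm_nonneg)
  finally show ?le unfolding eq .
qed

text \<open>Pairing with the adjoint image is a bounded functional on \<open>L^p\<close>, hence
  given by some \<open>g'\<close> in \<open>L^q\<close>. Testing on indicators identifies
  \<open>g'\<close> with the adjoint image almost everywhere.\<close>

lemma kernel_adjoint_Lp:
  assumes g: "g \<in> Lp_fun q M"
  shows "(\<lambda>w. LINT z|M. cnj (K z w) * g z) \<in> Lp_fun q M"
proof -
  interpret finite_measure M by (rule fin)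
  note [measurable] = Lp_funD(1)[OF g]
  define k where "k w = (LINT z|M. cnj (K z w) * g z)" for w
  have k [measurable]: "k \<in> borel_measurable M" unfolding k_def by measurable
  note Fubini = kernel_adjoint_Fubini[OF _ g, folded k_def]
  obtain g' where g': "g' \<in> Lp_fun q M"
    and eq: "\<And>f. f \<in> Lp_fun p M \<Longrightarrow> (LINT w|M. f w * cnj (k w)) = (LINT w|M. f w * cnj (g' w))"
  proof (rule Lp_subspace_functional_representation[OF p pq order_refl,
        where l = "\<lambda>f. LINT w|M. f w * cnj (k w)" and C = "C * Lp_seminorm q M g"])
    show "Lp_fun p M \<noteq> {}" using Lp_fun_indicator[OF fin sets.empty_sets] by blast
    show "(LINT w|M. (f w + h w) * cnj (k w)) = (LINT w|M. f w * cnj (k w)) + (LINT w|M. h w * cnj (k w))"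
      if "f \<in> Lp_fun p M" "h \<in> Lp_fun p M" for f h
      using Fubini(1)[OF that(1)] Fubini(1)[OF that(2)] by (simp add: distrib_right)
    show "norm (LINT w|M. f w * cnj (k w)) \<le> C * Lp_seminorm q M g * Lp_seminorm p M f"
      if "f \<in> Lp_fun p M" for f
      using Fubini(3)[OF that] by (simp add: mult_ac)
  qed (auto intro: Lp_fun_add Lp_fun_cmult p simp: mult.assoc)
  have "AE w in M. cnj (k w) = cnj (g' w)"
  proof (rule density_unique_banach)
    \<comment> \<open>The constant 1 lies in \<open>L^p\<close> since the measure is finite; pairing
      with it makes both densities integrable, so their integrals over sets can be compared.\<close>
    have one: "(\<lambda>w. indicator (space M) w) \<in> Lp_fun p M" by (intro Lp_fun_indicator fin) simp
    show "integrable M (\<lambda>w. cnj (k w))" "integrable M (\<lambda>w. cnj (g' w))"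
      using Fubini(1)[OF one] Lp_pairing_integrable[OF one g' p pq]
      by (simp_all cong: Bochner_Integration.integrable_cong)
    fix A assume A: "A \<in> sets M"
    have ind: "indicator A w *\<^sub>R c = indicator A w * c" for w and c :: complex
      by (simp add: indicator_def)
    show "set_lebesgue_integral M A (\<lambda>w. cnj (k w)) = set_lebesgue_integral M A (\<lambda>w. cnj (g' w))"
      unfolding set_lebesgue_integral_def ind by (rule eq[OF Lp_fun_indicator[OF fin A]])
  qed
  then have "AE w in M. norm (k w) \<le> norm (g' w)" by eventually_elim simp
  then have "k \<in> Lp_fun q M"
    using conjugate_exponent(1)[OF p pq] by (intro Lp_fun_bound[OF g' k]) auto
  then show ?thesis by (simp add: k_def[abs_def])
qed

end

text \<open>The kernel is measurable only for the completed measure on the product, whereas Fubini's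
  theorem needs the product sigma-algebra. A Borel modification differs on a null set, almost all of
  whose sections are null in either variable.\<close>

lemma lebesgue_on_product_borel_representative:
  fixes K :: "'a::euclidean_space \<Rightarrow> 'b::euclidean_space \<Rightarrow> complex"
  assumes S: "S \<in> sets borel" and T: "T \<in> sets borel"
    and K: "(\<lambda>(x, y). K x y) \<in> borel_measurable (lebesgue_on (S \<times> T))"
  obtains K' where "(\<lambda>(x, y). K' x y) \<in> borel_measurable (borel \<Otimes>\<^sub>M borel)"
    "AE x in lebesgue_on S. AE y in lebesgue_on T. K x y = K' x y"
    "AE y in lebesgue_on T. AE x in lebesgue_on S. K x y = K' x y"
proof -
  let ?K = "\<lambda>x. indicator (S \<times> T) x *\<^sub>R (case x of (x, y) \<Rightarrow> K x y)"
  have ST: "S \<times> T \<in> sets borel"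
    using pair_measureI[OF S T] unfolding borel_prod .
  have "?K \<in> borel_measurable lebesgue"
    using K ST by (subst (asm) borel_measurable_restrict_space_iff) auto
  then have "(\<lambda>x. Re (?K x)) \<in> borel_measurable lebesgue" "(\<lambda>x. Im (?K x)) \<in> borel_measurable lebesgue"
    by measurable
  from this[THEN completion_ex_borel_measurable_real]
  obtain R I where [measurable]: "R \<in> borel_measurable lborel" "I \<in> borel_measurable lborel"
    and RI: "AE x in lborel. Re (?K x) = R x" "AE x in lborel. Im (?K x) = I x"
    by blast
  define K' where "K' x y = Complex (R (x, y)) (I (x, y))" for x y
  have K': "(\<lambda>(x, y). K' x y) \<in> borel_measurable (borel \<Otimes>\<^sub>M borel)"
    by (simp add: K'_def Complex_eq case_prod_unfold borel_prod)
  have "AE x in lborel. x \<in> S \<times> T \<longrightarrow> (case x of (x, y) \<Rightarrow> K x y = K' x y)"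
    using RI by eventually_elim (auto simp: K'_def complex_eq_iff)
  then obtain N where N: "N \<in> sets lborel" "emeasure lborel N = 0"
    "{x \<in> space lborel. \<not> (x \<in> S \<times> T \<longrightarrow> (case x of (x, y) \<Rightarrow> K x y = K' x y))} \<subseteq> N"
    by (auto elim: AE_E)
  have eq: "K x y = K' x y" if "(x, y) \<notin> N" "x \<in> S" "y \<in> T" for x y
    using that N(3) by auto
  have "AE x in lborel \<Otimes>\<^sub>M lborel. x \<notin> N"
    unfolding lborel_prod using N by (intro AE_not_in) (simp add: null_sets_def)
  then have N1: "AE x in lborel. AE y in lborel. (x, y) \<notin> N"
    by (rule lborel_pair.AE_pair)
  \<comment> \<open>Swapping the two almost everywhere quantifiers requires the exceptional set to
    be measurable in the product.\<close>
  have "{x \<in> space (lborel \<Otimes>\<^sub>M lborel). (fst x, snd x) \<notin> N} \<in> sets (lborel \<Otimes>\<^sub>M lborel)"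
    using sets.compl_sets[OF N(1)] unfolding lborel_prod by (simp add: set_diff_eq)
  from lborel_pair.AE_commute[of "\<lambda>x y. (x, y) \<notin> N", OF this] N1
  have N2: "AE y in lborel. AE x in lborel. (x, y) \<notin> N" by simp
  have on: "AE x in lebesgue_on A. Q x" if "A \<in> sets borel" "AE x in lborel. x \<in> A \<longrightarrow> Q x"
    for A :: "'c::euclidean_space set" and Q
    using that by (subst AE_restrict_space_iff) (auto intro: AE_completion)
  show ?thesis
  proof (rule that[OF K'])
    show "AE x in lebesgue_on S. AE y in lebesgue_on T. K x y = K' x y"
    proof (rule on[OF S], use N1 in eventually_elim, intro impI)
      fix x assume "AE y in lborel. (x, y) \<notin> N" "x \<in> S"
      then show "AE y in lebesgue_on T. K x y = K' x y"
        by (intro on[OF T]) (auto elim: eventually_mono intro: eq)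
    qed
    show "AE y in lebesgue_on T. AE x in lebesgue_on S. K x y = K' x y"
    proof (rule on[OF T], use N2 in eventually_elim, intro impI)
      fix y assume "AE x in lborel. (x, y) \<notin> N" "y \<in> T"
      then show "AE x in lebesgue_on S. K x y = K' x y"
        by (intro on[OF S]) (auto elim: eventually_mono intro: eq)
    qed
  qed
qed

subsection \<open>Bergman spaces\<close>

lemma Lp_space_eq: "Lp_space p \<Omega> = Lp_fun p (lebesgue_on \<Omega>)"
  by (simp add: Lp_space_def Lp_fun_def)

lemma Lp_norm_eq: "Lp_norm p \<Omega> = Lp_seminorm p (lebesgue_on \<Omega>)"
  by (simp add: Lp_norm_def Lp_seminorm_def fun_eq_iff)

lemma holomorphic_several_add:
  assumes "holomorphic_several f \<Omega>" "holomorphic_several g \<Omega>"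
  shows "holomorphic_several (\<lambda>z. f z + g z) \<Omega>"
  unfolding holomorphic_several_def
proof
  fix z assume "z \<in> \<Omega>"
  then obtain D E where "(f has_derivative D) (at z)" "\<forall>c v. D (c *s v) = c * D v"
    "(g has_derivative E) (at z)" "\<forall>c v. E (c *s v) = c * E v"
    using assms unfolding holomorphic_several_def by blast
  then show "\<exists>D. ((\<lambda>z. f z + g z) has_derivative D) (at z) \<and> (\<forall>c v. D (c *s v) = c * D v)"
    by (intro exI[of _ "\<lambda>v. D v + E v"]) (auto intro: has_derivative_add simp: distrib_left)
qed

lemma holomorphic_several_cmult:
  assumes "holomorphic_several f \<Omega>"
  shows "holomorphic_several (\<lambda>z. c * f z) \<Omega>"
  unfolding holomorphic_several_def
proof
  fix z assume "z \<in> \<Omega>"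
  then obtain D where "(f has_derivative D) (at z)" "\<forall>c v. D (c *s v) = c * D v"
    using assms unfolding holomorphic_several_def by blast
  then show "\<exists>D. ((\<lambda>z. c * f z) has_derivative D) (at z) \<and> (\<forall>c v. D (c *s v) = c * D v)"
    by (intro exI[of _ "\<lambda>v. c * D v"]) (auto intro: has_derivative_mult_right)
qed

lemma holomorphic_several_continuous_on:
  assumes "holomorphic_several f \<Omega>"
  shows "continuous_on \<Omega> f"
  using assms unfolding holomorphic_several_def
  by (blast intro: continuous_at_imp_continuous_on has_derivative_continuous)

lemma bergman_Lp: "bergman p \<Omega> \<subseteq> Lp_fun p (lebesgue_on \<Omega>)"
  by (auto simp: bergman_def Lp_space_eq)

lemma zero_in_bergman: "(\<lambda>_. 0) \<in> bergman p \<Omega>"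
  by (auto simp: bergman_def Lp_space_def holomorphic_several_def intro!: exI[of _ "\<lambda>_. 0"])

lemma bergman_add:
  assumes "f \<in> bergman p \<Omega>" "g \<in> bergman p \<Omega>" "1 < p"
  shows "(\<lambda>z. f z + g z) \<in> bergman p \<Omega>"
  using assms by (auto simp: bergman_def Lp_space_eq intro: holomorphic_several_add Lp_fun_add)

lemma bergman_cmult:
  assumes "f \<in> bergman p \<Omega>"
  shows "(\<lambda>z. c * f z) \<in> bergman p \<Omega>"
  using assms by (auto simp: bergman_def Lp_space_eq intro: holomorphic_several_cmult Lp_fun_cmult)

lemma bergman_pairing_integrable:
  assumes "1 < p" "1 / p + 1 / q = 1" "f \<in> bergman p \<Omega>" "g \<in> bergman q \<Omega>"
  shows "integrable (lebesgue_on \<Omega>) (\<lambda>z. f z * cnj (g z))"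
  using assms bergman_Lp by (blast intro: Lp_pairing_integrable)

lemma bergman_pairing_conjugate_linear:
  assumes "1 < p" "1 / p + 1 / q = 1"
  shows "conjugate_linear_on_bergman q p \<Omega> (bergman_pairing p \<Omega>)"
proof -
  have "(LINT z|lebesgue_on \<Omega>. f z * cnj (c * g z)) = cnj c * (LINT z|lebesgue_on \<Omega>. f z * cnj (g z))"
    for c f and g :: "complex^'a \<Rightarrow> complex"
    unfolding complex_cnj_mult by (subst mult.left_commute) simp
  then show ?thesis
    using bergman_pairing_integrable[OF assms, where \<Omega> = \<Omega>]
    by (auto simp: conjugate_linear_on_bergman_def bergman_pairing_def distrib_left simp del: complex_cnj_mult)
qed

text \<open>The pairing takes values in the dual, with Hoelder's inequality supplying the
  bound.\<close>

lemma bergman_pairing_dual: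
  assumes p: "1 < p" and pq: "1 / p + 1 / q = 1" and g: "g \<in> bergman q \<Omega>"
  shows "bergman_pairing p \<Omega> g \<in> bergman_dual p \<Omega>"
proof -
  have "norm (bergman_pairing p \<Omega> g f) \<le> Lp_norm q \<Omega> g * Lp_norm p \<Omega> f" if "f \<in> bergman p \<Omega>" for f
    using Lp_pairing_norm_le[of f p "lebesgue_on \<Omega>" g q] that g bergman_Lp p pq
    by (auto simp: bergman_pairing_def Lp_norm_eq mult.commute)
  then show ?thesis
    using bergman_pairing_integrable[OF p pq _ g] p
    by (auto simp: bergman_dual_def bergman_pairing_def bergman_add bergman_cmult distrib_right mult.assoc)
qed

section \<open>Surjectivity of the Bergman pairing\<close>

theorem proposition0p2:
  fixes \<Omega> :: "(complex^'n) set"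
    and p q :: real
    and T :: "(complex^'n \<Rightarrow> complex) \<Rightarrow> complex^'n \<Rightarrow> complex"
    and P :: "complex^'n \<Rightarrow> complex^'n \<Rightarrow> complex"
  assumes domain: "open \<Omega>" "connected \<Omega>" "\<Omega> \<noteq> {}" "bounded \<Omega>"
    and p: "1 < p"
    and conjugate: "1 / p + 1 / q = 1"
    and kernel_measurable: "(\<lambda>(z, w). P z w) \<in> borel_measurable (lebesgue_on (\<Omega> \<times> \<Omega>))"
    and T_bounded: "bounded_linear_Lp_bergman 2 \<Omega> T"
    and T_integral: "\<And>f. f \<in> Lp_space 2 \<Omega> \<Longrightarrow>
          kernel_op_converges \<Omega> P f \<and> (AE z in lebesgue_on \<Omega>. T f z = kernel_op \<Omega> P f z)"
    and abs_bounded: "\<exists>C>0. \<forall>f\<in>Lp_space p \<Omega>.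
          kernel_op_converges \<Omega> (abs_kernel P) f \<and>
          kernel_op \<Omega> (abs_kernel P) f \<in> Lp_space p \<Omega> \<and>
          Lp_norm p \<Omega> (kernel_op \<Omega> (abs_kernel P) f) \<le> C * Lp_norm p \<Omega> f"
    and reproducing: "\<And>h. h \<in> bergman p \<Omega> \<Longrightarrow>
          kernel_op_converges \<Omega> P h \<and> (AE z in lebesgue_on \<Omega>. kernel_op \<Omega> P h z = h z)"
    and adjoint_holomorphic: "\<And>g. g \<in> Lp_space q \<Omega> \<Longrightarrow>
          kernel_op_converges \<Omega> (adjoint_kernel P) g \<and>
          (\<exists>G. holomorphic_several G \<Omega> \<and>
            (AE w in lebesgue_on \<Omega>. kernel_op \<Omega> (adjoint_kernel P) g w = G w))"
  shows "conjugate_linear_on_bergman q p \<Omega> (bergman_pairing p \<Omega>) \<and>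
         bergman_pairing p \<Omega> ` bergman q \<Omega> = bergman_dual p \<Omega>"
proof -
  let ?M = "lebesgue_on \<Omega>"
  have \<Omega>: "\<Omega> \<in> sets borel" "\<Omega> \<in> sets lebesgue" using domain(1) by auto
  have fin: "finite_measure ?M"
    using domain by (intro finite_measure_lebesgue_on lmeasurable_open)
  then interpret finite_measure ?M .
  \<comment> \<open>\<open>K\<close> is a Borel version of \<open>P\<close>. Agreement along rows
    (\<open>K1\<close>) transfers the statements on \<open>P\<close> and its absolute value,
    agreement along columns (\<open>K2\<close>) those on the adjoint.\<close>
  obtain K where K_borel: "(\<lambda>(z, w). K z w) \<in> borel_measurable (borel \<Otimes>\<^sub>M borel)"
    and K1: "AE z in ?M. AE w in ?M. P z w = K z w"
    and K2: "AE w in ?M. AE z in ?M. P z w = K z w"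
    by (rule lebesgue_on_product_borel_representative[OF \<Omega>(1) \<Omega>(1) kernel_measurable])
  have id [measurable]: "(\<lambda>z. z) \<in> measurable ?M borel"
    by (intro measurable_restrict_space1 measurable_completion) simp
  have "(\<lambda>x. (fst x, snd x)) \<in> measurable (?M \<Otimes>\<^sub>M ?M) (borel \<Otimes>\<^sub>M borel)"
    by (intro measurable_Pair measurable_compose[OF measurable_fst id] measurable_compose[OF measurable_snd id])
  from measurable_compose[OF this K_borel]
  have K [measurable]: "(\<lambda>(z, w). K z w) \<in> borel_measurable (?M \<Otimes>\<^sub>M ?M)"
    by (simp add: case_prod_unfold)
  have K_row: "K z \<in> borel_measurable ?M" if "z \<in> space ?M" for z
    using measurable_compose_Pair1[OF that K] by simp
  have K_col: "(\<lambda>z. K z w) \<in> borel_measurable ?M" if "w \<in> space ?M" for w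
    using that K by measurable
  obtain C where abs_bd: "\<And>f. f \<in> Lp_fun p ?M \<Longrightarrow>
      kernel_op_converges \<Omega> (abs_kernel P) f \<and>
      kernel_op \<Omega> (abs_kernel P) f \<in> Lp_fun p ?M \<and>
      Lp_seminorm p ?M (kernel_op \<Omega> (abs_kernel P) f) \<le> C * Lp_seminorm p ?M f"
    using abs_bounded unfolding Lp_space_eq Lp_norm_eq by blast
  \<comment> \<open>The bound for the absolute kernel is applied to \<open>|f|\<close>, which has
    the same seminorm as \<open>f\<close>, and then rewritten row by row in terms of
    \<open>K\<close>.\<close>
  have abs_K:
    "(AE z in ?M. integrable ?M (\<lambda>w. norm (K z w) * norm (f w))) \<and>
     (\<lambda>z. complex_of_real (LINT w|?M. norm (K z w) * norm (f w))) \<in> Lp_fun p ?M \<and>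
     Lp_seminorm p ?M (\<lambda>z. complex_of_real (LINT w|?M. norm (K z w) * norm (f w))) \<le> C * Lp_seminorm p ?M f"
    if f: "f \<in> Lp_fun p ?M" for f
  proof -
    note [measurable] = Lp_funD(1)[OF f]
    let ?f = "\<lambda>w. complex_of_real (norm (f w))"
    let ?u = "\<lambda>z. complex_of_real (LINT w|?M. norm (K z w) * norm (f w))"
    note bd = abs_bd[OF Lp_fun_norm[OF f]]
    have "AE z in ?M. integrable ?M (\<lambda>w. abs_kernel P z w * ?f w)"
      using bd by (simp add: kernel_op_converges_def)
    then have *: "AE z in ?M. integrable ?M (\<lambda>w. norm (K z w) * norm (f w)) \<and>
        kernel_op \<Omega> (abs_kernel P) ?f z = ?u z"
      using K1 AE_space
    proof eventually_elim
      case (elim z)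
      note [measurable] = K_row[OF elim(3)]
      have eq: "AE w in ?M. abs_kernel P z w * ?f w = complex_of_real (norm (K z w) * norm (f w))"
        using elim(2) by eventually_elim (simp add: abs_kernel_def)
      have "integrable ?M (\<lambda>w. complex_of_real (norm (K z w) * norm (f w)))"
        by (rule integrable_cong_AE_imp[OF elim(1)]) (use eq in \<open>auto elim: eventually_mono\<close>)
      moreover have "kernel_op \<Omega> (abs_kernel P) ?f z = (LINT w|?M. complex_of_real (norm (K z w) * norm (f w)))"
        unfolding kernel_op_def using elim(1) eq by (intro integral_cong_AE) auto
      ultimately show ?case
        by (simp only: complex_of_real_integrable_eq integral_complex_of_real simp_thms)
    qed
    have u: "?u \<in> borel_measurable ?M" by measurable
    have uL: "?u \<in> Lp_fun p ?M"
      using * p by (intro Lp_fun_bound[OF conjunct1[OF conjunct2[OF bd]] u]) (auto elim: eventually_mono)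
    have "Lp_seminorm p ?M ?u = Lp_seminorm p ?M (kernel_op \<Omega> (abs_kernel P) ?f)"
      using * bd u by (intro Lp_seminorm_cong_AE) (auto elim: eventually_mono dest: Lp_funD)
    also have "\<dots> \<le> C * Lp_seminorm p ?M f"
      using bd by (simp add: Lp_seminorm_def)
    finally show ?thesis using * uL by auto
  qed
  have surj: "l \<in> bergman_pairing p \<Omega> ` bergman q \<Omega>" if l: "l \<in> bergman_dual p \<Omega>" for l
  proof -
    obtain B where B: "\<And>f. f \<in> bergman p \<Omega> \<Longrightarrow> norm (l f) \<le> B * Lp_seminorm p ?M f"
      using l unfolding bergman_dual_def Lp_norm_eq by blast
    obtain g where g: "g \<in> Lp_fun q ?M"
      and lg: "\<And>f. f \<in> bergman p \<Omega> \<Longrightarrow> l f = (LINT z|?M. f z * cnj (g z))"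
    proof (rule Lp_subspace_functional_representation[OF p conjugate bergman_Lp, where l = l and C = B])
      show "bergman p \<Omega> \<noteq> {}" using zero_in_bergman by blast
    qed (use l B p that in \<open>auto simp: bergman_dual_def intro: bergman_add bergman_cmult\<close>)
    note [measurable] = Lp_funD(1)[OF g]
    let ?k = "\<lambda>w. LINT z|?M. cnj (K z w) * g z"
    obtain G where G: "holomorphic_several G \<Omega>"
      and G_eq: "AE w in ?M. kernel_op \<Omega> (adjoint_kernel P) g w = G w"
      and conv: "AE w in ?M. integrable ?M (\<lambda>z. adjoint_kernel P w z * g z)"
      using adjoint_holomorphic[of g] g by (auto simp: Lp_space_eq kernel_op_converges_def)
    \<comment> \<open>The adjoint image of \<open>g\<close> is holomorphic only up to a null set, so
      its representative \<open>G\<close> is the candidate for the preimage of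
      \<open>l\<close>.\<close>
    have kG: "AE w in ?M. ?k w = G w"
      using G_eq conv K2 AE_space
    proof eventually_elim
      case (elim w)
      note [measurable] = K_col[OF elim(4)]
      have "kernel_op \<Omega> (adjoint_kernel P) g w = ?k w"
        unfolding kernel_op_def using elim(2,3)
        by (intro integral_cong_AE) (auto simp: adjoint_kernel_def elim: eventually_mono)
      then show ?case using elim(1) by simp
    qed
    have [measurable]: "G \<in> borel_measurable ?M"
      using continuous_imp_measurable_on_sets_lebesgue[OF holomorphic_several_continuous_on[OF G] \<Omega>(2)] .
    have kL: "?k \<in> Lp_fun q ?M"
      using abs_K by (intro kernel_adjoint_Lp[OF fin K p conjugate _ _ _ g]) auto
    then have "G \<in> Lp_fun q ?M"
      using kG conjugate_exponent(1)[OF p conjugate]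
      by (intro Lp_fun_bound[OF kL]) (auto elim: eventually_mono)
    then have GB: "G \<in> bergman q \<Omega>" using G by (simp add: bergman_def Lp_space_eq)
    have "l h = bergman_pairing p \<Omega> G h" if h: "h \<in> bergman p \<Omega>" for h
    proof -
      have hL: "h \<in> Lp_fun p ?M" using h bergman_Lp by blast
      note [measurable] = Lp_funD(1)[OF hL]
      have conv: "AE z in ?M. integrable ?M (\<lambda>w. P z w * h w)"
        and rep: "AE z in ?M. kernel_op \<Omega> P h z = h z"
        using reproducing[OF h] by (auto simp: kernel_op_converges_def)
      have hK: "AE z in ?M. (LINT w|?M. K z w * h w) = h z"
        using rep conv K1 AE_space
      proof eventually_elim
        case (elim z)
        note [measurable] = K_row[OF elim(4)]
        have "kernel_op \<Omega> P h z = (LINT w|?M. K z w * h w)"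
          unfolding kernel_op_def using elim(2,3)
          by (intro integral_cong_AE) (auto elim: eventually_mono)
        then show ?case using elim(1) by simp
      qed
      \<comment> \<open>Reproduce \<open>h\<close> by the kernel, move the kernel onto
        \<open>g\<close> by Fubini, then replace the adjoint image by \<open>G\<close>.\<close>
      have "l h = (LINT z|?M. h z * cnj (g z))" by (rule lg[OF h])
      also have "\<dots> = (LINT z|?M. (LINT w|?M. K z w * h w) * cnj (g z))"
        using hK by (intro integral_cong_AE) (auto elim: eventually_mono)
      also have "\<dots> = (LINT w|?M. h w * cnj (?k w))"
        using abs_K by (intro kernel_adjoint_Fubini(2)[OF fin K p conjugate _ _ _ hL g, symmetric]) auto
      also have "\<dots> = (LINT w|?M. h w * cnj (G w))"
        using kG Lp_funD(1)[OF kL] by (intro integral_cong_AE) (auto elim: eventually_mono)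
      finally show ?thesis using h by (simp add: bergman_pairing_def)
    qed
    \<comment> \<open>Both functionals are \<open>undefined\<close> off the Bergman space, so
      agreement on it gives equality.\<close>
    moreover have "l \<in> extensional (bergman p \<Omega>)" using l by (simp add: bergman_dual_def)
    ultimately have "l = bergman_pairing p \<Omega> G"
      by (intro extensionalityI[of _ "bergman p \<Omega>"]) (auto simp: bergman_pairing_def)
    then show ?thesis using GB by blast
  qed
  show ?thesis
    using bergman_pairing_conjugate_linear[OF p conjugate] bergman_pairing_dual[OF p conjugate] surj by blast
qed

end
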